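(* Let $\mathcal{A} = A_1, A_2, \dots$ be a lineage of deterministic autopoietic automata reading a single input stream (each $A_{i+1}$ being the new offspring of $A_i$ and continuing to read the input stream from the position reached by $A_i$). Then there is a deterministic interactive Turing machine that simulates $\mathcal{A}$: on every input stream it produces the same output stream as the lineage, where the symbols read and written by the automata $A_i$ are represented by fixed encodings over the Turing machine's fixed input and output alphabets.
   Context: A (deterministic) autopoietic automaton $A$ is a finite automaton with state set $Q$, a start state $q_0 \in Q\setminus R$, a subset $R\subseteq Q$ of reproducing-mode states (states in $Q\setminus R$ are transducer-mode states), a special state $q_1\in R$, and a transition partial function $\delta$ (a partial function of (observed symbol, current state), giving a new state, a symbol to write, and a direction). Symbols come from a potentially infinite alphabet $\sigma_1,\sigma_2,\dots$, with $\sigma_i$ encoded in unary by $i$. The automaton has a finite read-only input tape which always contains the code of $A$: a sequence, in arbitrary order, of 5-tuples (observed symbol, current state, new state, new symbol, direction), one per transition of $\delta$, written in binary/unary encoding. In reproducing mode (states in $R$) the automaton works like a Turing machine head on this read-only input tape (moving left/right) and writes symbols onto a one-way output tape. In transducer mode (states in $Q\setminus R$) it does not touch the tapes, but reads one symbol at a time from an input buffer connected to an infinite input stream and writes one symbol at a time into an output buffer, producing an output stream. When reproducing mode ends by entering $q_1$, $A$ splits into two automata: the old $A$ with the same input tape and an empty output tape, and the offspring $A'$ whose input tape is the previous output tape and whose output tape is empty; both start in $q_0$ with heads at the left end of their tapes. If the offspring's input tape is not a proper encoding of a transition function, the offspring stops. The offspring relation defines a tree of autopoietic automata; a lineage is a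 path $A_1, A_2, \dots$ in this tree starting from a single automaton $A_1$. An interactive Turing machine is a Turing machine that reads one symbol at a time from an input buffer connected to an input stream and writes one symbol at a time to an output buffer, creating an output stream. *)

theory Defs
  imports Main "HOL-Library.Sublist"
begin

text \<open>Symbols sigma_i are represented by natural numbers i (i >= 1); the number 0 is
  used as the blank (read outside the finite input tape) and, when written, means
  "write nothing".  States are natural numbers.  Conventions fixed for all automata:
  the start state q0 is 0, the special state q1 is 1, and the reproducing-mode
  states R are the odd numbers (so the mode of a state can be read off its code).\<close>

datatype dir = Left | Right

definition q0_st :: nat where "q0_st = 0"
definition q1_st :: nat where "q1_st = 1"
definition is_R :: "nat \<Rightarrow> bool" where "is_R q \<longleftrightarrow> odd q"

type_synonym trans = "nat \<times> nat \<times> nat \<times> nat \<times> dir"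
  (* (observed symbol, current state, new state, new symbol, direction) *)

fun bin :: "nat \<Rightarrow> nat list" where
  "bin n = (if n = 0 then [] else bin (n div 2) @ [if odd n then 1 else 2])"

definition unary :: "nat \<Rightarrow> nat list" where
  "unary n = replicate n 1"

fun dir_code :: "dir \<Rightarrow> nat list" where
  "dir_code Left = [1]"
| "dir_code Right = [1, 1]"

fun enc_trans :: "trans \<Rightarrow> nat list" where
  "enc_trans (a, q, q', b, d) =
     unary a @ [3] @ bin q @ [3] @ bin q' @ [3] @ unary b @ [3] @ dir_code d @ [4]"

definition enc_code :: "trans list \<Rightarrow> nat list" where
  "enc_code ts = concat (map enc_trans ts)"

definition trans_key :: "trans \<Rightarrow> nat \<times> nat" where
  "trans_key t = (case t of (a, q, _, _, _) \<Rightarrow> (a, q))"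

definition det_code :: "trans list \<Rightarrow> bool" where
  "det_code ts \<longleftrightarrow> distinct (map trans_key ts)"

definition proper :: "nat list \<Rightarrow> bool" where
  "proper tape \<longleftrightarrow> (\<exists>ts. tape = enc_code ts \<and> det_code ts)"

definition delta_of :: "nat list \<Rightarrow> nat \<times> nat \<Rightarrow> (nat \<times> nat \<times> dir) option" where
  "delta_of tape =
     (if proper tape then
        map_of (map (\<lambda>(a, q, q', b, d). ((a, q), (q', b, d)))
                    (SOME ts. tape = enc_code ts \<and> det_code ts))
      else Map.empty)"

text \<open>Configuration of the currently active automaton of the lineage: its input tape
  (= its code), its state, its head position on the input tape, the contents of its
  one-way output tape, and the position reached in the common input stream.\<close>
record lcfg =
  ltape :: "nat list"
  lst :: nat
  lhd :: nat
  lotape :: "nat list"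
  lpos :: nat

definition tape_at :: "nat list \<Rightarrow> nat \<Rightarrow> nat" where
  "tape_at tp h = (if h < length tp then tp ! h else 0)"

fun move :: "dir \<Rightarrow> nat \<Rightarrow> nat" where
  "move Left h = h - 1"
| "move Right h = Suc h"

definition out_sym :: "nat \<Rightarrow> nat list" where
  "out_sym b = (if b = 0 then [] else [b])"

definition init_cfg :: "nat list \<Rightarrow> nat \<Rightarrow> lcfg" where
  "init_cfg tp p = \<lparr>ltape = tp, lst = q0_st, lhd = 0, lotape = [], lpos = p\<rparr>"

text \<open>One step of the lineage on input stream x.  Returns the new configuration and
  the symbols appended to the output stream, or None if the lineage stops (no
  applicable transition, or the current automaton's tape is not a proper code).
  On entering q1 the offspring becomes the active automaton: its input tape is the
  output tape, it starts in q0 with head at the left end, empty output tape, and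
  continues reading the input stream where the parent stopped.\<close>
definition lstep :: "(nat \<Rightarrow> nat) \<Rightarrow> lcfg \<Rightarrow> (lcfg \<times> nat list) option" where
  "lstep x c =
    (if \<not> proper (ltape c) then None else
     if is_R (lst c) then
       (case delta_of (ltape c) (tape_at (ltape c) (lhd c), lst c) of
          None \<Rightarrow> None
        | Some (q', b, d) \<Rightarrow>
            (let ot = lotape c @ out_sym b in
             if q' = q1_st then Some (init_cfg ot (lpos c), [])
             else Some (c\<lparr>lst := q', lhd := move d (lhd c), lotape := ot\<rparr>, [])))
     else
       (case delta_of (ltape c) (x (lpos c), lst c) of
          None \<Rightarrow> None
        | Some (q', b, d) \<Rightarrow>
            (if q' = q1_st then Some (init_cfg (lotape c) (Suc (lpos c)), out_sym b)
             else Some (c\<lparr>lst := q', lpos := Suc (lpos c)\<rparr>, out_sym b))))"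

fun lrun :: "(nat \<Rightarrow> nat) \<Rightarrow> nat \<Rightarrow> lcfg \<Rightarrow> nat list" where
  "lrun x 0 c = []"
| "lrun x (Suc n) c = (case lstep x c of None \<Rightarrow> [] | Some (c', w) \<Rightarrow> w @ lrun x n c')"

text \<open>One two-way infinite work tape (blank 0).  In each state, depending on the scanned
  work-tape symbol, the machine either performs an ordinary Turing step, or reads one
  symbol from the input buffer and branches on it, or writes one symbol to the output
  buffer.\<close>
datatype itm_act =
    Work nat nat dir          (* new state, written symbol, head move *)
  | Read "nat \<Rightarrow> nat"       (* new state as a function of the symbol read *)
  | Emit nat nat              (* output symbol, new state *)

record itm =
  i_states :: "nat set"
  i_start :: nat
  i_tapealph :: "nat set"
  i_inalph :: "nat set"
  i_outalph :: "nat set"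
  i_delta :: "nat \<Rightarrow> nat \<Rightarrow> itm_act option"

definition wf_itm :: "itm \<Rightarrow> bool" where
  "wf_itm M \<longleftrightarrow>
     finite (i_states M) \<and> finite (i_tapealph M) \<and> finite (i_inalph M) \<and> finite (i_outalph M) \<and>
     i_start M \<in> i_states M \<and> (0::nat) \<in> i_tapealph M \<and>
     (\<forall>q \<in> i_states M. \<forall>a \<in> i_tapealph M.
        case i_delta M q a of
          None \<Rightarrow> True
        | Some (Work q' b d) \<Rightarrow> q' \<in> i_states M \<and> b \<in> i_tapealph M
        | Some (Read f) \<Rightarrow> (\<forall>c \<in> i_inalph M. f c \<in> i_states M)
        | Some (Emit c q') \<Rightarrow> c \<in> i_outalph M \<and> q' \<in> i_states M)"

record icfg =
  ist :: nat
  itape :: "int \<Rightarrow> nat"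
  ihd :: int
  ipos :: nat

fun imove :: "dir \<Rightarrow> int \<Rightarrow> int" where
  "imove Left h = h - 1"
| "imove Right h = h + 1"

definition istep :: "itm \<Rightarrow> (nat \<Rightarrow> nat) \<Rightarrow> icfg \<Rightarrow> (icfg \<times> nat list) option" where
  "istep M y c =
    (case i_delta M (ist c) (itape c (ihd c)) of
       None \<Rightarrow> None
     | Some (Work q' b d) \<Rightarrow>
         Some (c\<lparr>ist := q', itape := (itape c)(ihd c := b), ihd := imove d (ihd c)\<rparr>, [])
     | Some (Read f) \<Rightarrow> Some (c\<lparr>ist := f (y (ipos c)), ipos := Suc (ipos c)\<rparr>, [])
     | Some (Emit s q') \<Rightarrow> Some (c\<lparr>ist := q'\<rparr>, [s]))"

fun irun :: "itm \<Rightarrow> (nat \<Rightarrow> nat) \<Rightarrow> nat \<Rightarrow> icfg \<Rightarrow> nat list" where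
  "irun M y 0 c = []"
| "irun M y (Suc n) c = (case istep M y c of None \<Rightarrow> [] | Some (c', w) \<Rightarrow> w @ irun M y n c')"

definition iinit :: "itm \<Rightarrow> icfg" where
  "iinit M = \<lparr>ist = i_start M, itape = (\<lambda>_. 0), ihd = 0, ipos = 0\<rparr>"

definition sym_enc :: "nat \<Rightarrow> nat list" where
  "sym_enc i = replicate i 1 @ [2]"

definition enc_prefix :: "(nat \<Rightarrow> nat) \<Rightarrow> nat \<Rightarrow> nat list" where
  "enc_prefix x k = concat (map (\<lambda>i. sym_enc (x i)) [0..<k])"

definition enc_stream :: "(nat \<Rightarrow> nat) \<Rightarrow> nat \<Rightarrow> nat" where
  "enc_stream x n = enc_prefix x (Suc n) ! n"

text \<open>Two (possibly finite) streams, each given as the chain of its finite prefixes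
  produced after n steps, are equal.\<close>
definition same_stream :: "(nat \<Rightarrow> 'a list) \<Rightarrow> (nat \<Rightarrow> 'a list) \<Rightarrow> bool" where
  "same_stream f g \<longleftrightarrow> (\<forall>n. \<exists>m. prefix (f n) (g m)) \<and> (\<forall>n. \<exists>m. prefix (g n) (f m))"

end

(*
The lineage is simulated by a stack machine that keeps the code, the state, the output tape and
the (unary) head position of the currently active automaton on stacks.  In every step it checks
that the code is proper, determines the observed symbol and searches the code for an applicable
transition.  The tape symbols may come from an infinite alphabet, but a proper code contains only
the symbols 1, ..., 4, so it suffices to remember of all other written symbols that they are "other".
Finally, finitely many stacks fit on the tracks of a single Turing machine tape.
*)
theory Submission
  imports Defs
begin

text \<open>Offspring codes grow without bound along the lineage, so only the code of the first
  automaton can be wired into the finite control; every later one must be interpreted from data. Two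
  kinds of unbounded symbols are treated differently. A symbol written on an output tape matters
  only once that tape has become a code, and an improper tape stops the offspring before it observes
  anything; hence truncating such symbols is invisible. A symbol of the input stream must be
  compared exactly with arbitrary unary numbers of the code, so it stays in unary on a stack.
  \<open>same_stream\<close> also forbids the machine to write more than the lineage does. Hence a
  stopping lineage has to be matched by a machine that halts without further output, and aborting is
  part of the program semantics. The programs contain functions on symbols and so are infinite
  objects in general; their control becomes finite because only symbols up to a fixed bound are ever
  popped.\<close>

section \<open>Runs of deterministic step functions, and simulations between them\<close>

fun grun :: "('c \<Rightarrow> ('c \<times> 'o list) option) \<Rightarrow> nat \<Rightarrow> 'c \<Rightarrow> 'o list" where
  "grun st 0 c = []"
| "grun st (Suc n) c = (case st c of None \<Rightarrow> [] | Some (c', w) \<Rightarrow> w @ grun st n c')"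

lemma lrun_eq_grun: "lrun x n c = grun (lstep x) n c"
  by (induction n arbitrary: c) (auto split: option.splits)

lemma irun_eq_grun: "irun M y n c = grun (istep M y) n c"
  by (induction n arbitrary: c) (auto split: option.splits)

inductive reachn :: "('c \<Rightarrow> ('c \<times> 'o list) option) \<Rightarrow> nat \<Rightarrow> 'c \<Rightarrow> 'o list \<Rightarrow> 'c \<Rightarrow> bool" for st where
  refl: "reachn st 0 c [] c"
| step: "st c = Some (c1, w1) \<Longrightarrow> reachn st n c1 w2 c' \<Longrightarrow> reachn st (Suc n) c (w1 @ w2) c'"

definition reach :: "('c \<Rightarrow> ('c \<times> 'o list) option) \<Rightarrow> 'c \<Rightarrow> 'o list \<Rightarrow> 'c \<Rightarrow> bool" where
  "reach st c w c' \<longleftrightarrow> (\<exists>n. reachn st n c w c')"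

text \<open>The simulating machine may work for a while before it notices that the lineage has
  stopped, so it is only required to get stuck eventually and to write nothing until then.\<close>

definition halts_silently :: "('c \<Rightarrow> ('c \<times> 'o list) option) \<Rightarrow> 'c \<Rightarrow> bool" where
  "halts_silently st c \<longleftrightarrow> (\<exists>c'. reach st c [] c' \<and> st c' = None)"

lemma reachn_trans:
  "reachn st m a u b \<Longrightarrow> reachn st n b v c \<Longrightarrow> reachn st (m + n) a (u @ v) c"
  by (induction rule: reachn.induct) (auto intro: reachn.step)

lemma reach_refl: "reach st c [] c"
  unfolding reach_def by (blast intro: reachn.refl)

lemma reach_trans: "reach st a u b \<Longrightarrow> reach st b v c \<Longrightarrow> reach st a (u @ v) c"
  unfolding reach_def by (blast intro: reachn_trans)

lemma reach_trans_silent: "reach st a [] b \<Longrightarrow> reach st b v c \<Longrightarrow> reach st a v c"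
  using reach_trans[of st a "[]" b v c] by simp

lemma reach_step: "st c = Some (c1, w) \<Longrightarrow> reach st c1 v c' \<Longrightarrow> reach st c (w @ v) c'"
  unfolding reach_def by (blast intro: reachn.step)

lemma reach_step_silent: "st c = Some (c1, []) \<Longrightarrow> reach st c1 v c' \<Longrightarrow> reach st c v c'"
  using reach_step[of st c c1 "[]"] by simp

lemma halts_silently_reach:
  "reach st a [] b \<Longrightarrow> halts_silently st b \<Longrightarrow> halts_silently st a"
  unfolding halts_silently_def by (auto dest: reach_trans_silent)

lemma halts_silently_stuck: "st c = None \<Longrightarrow> halts_silently st c"
  unfolding halts_silently_def by (intro exI[of _ c] conjI reach_refl)

lemma halts_silently_step:
  "st a = Some (b, []) \<Longrightarrow> halts_silently st b \<Longrightarrow> halts_silently st a"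
  by (erule halts_silently_reach[rotated]) (erule reach_step_silent, rule reach_refl)

lemma grun_reachn: "reachn st m c w c' \<Longrightarrow> grun st (m + n) c = w @ grun st n c'"
  by (induction rule: reachn.induct) auto

lemma grun_stuck: "st c = None \<Longrightarrow> grun st n c = []"
  by (cases n) auto

lemma grun_mono: "prefix (grun st n c) (grun st (n + k) c)"
  by (induction n arbitrary: c) (auto split: option.splits)

lemma grun_mono': "n \<le> m \<Longrightarrow> prefix (grun st n c) (grun st m c)"
  using grun_mono[of st n c "m - n"] by simp

text \<open>At least one step of the simulating machine per simulated step is needed for the
  second half of \<^const>\<open>same_stream\<close>.\<close>

lemma simulation_same_stream:
  fixes e :: "'o \<Rightarrow> 'p list"
  assumes sim_step: "\<And>a b a' w. R a b \<Longrightarrow> sA a = Some (a', w) \<Longrightarrow>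
      \<exists>b1 w1 w2 b'. sB b = Some (b1, w1) \<and> reach sB b1 w2 b' \<and>
        w1 @ w2 = concat (map e w) \<and> R a' b'"
    and sim_halt: "\<And>a b. R a b \<Longrightarrow> sA a = None \<Longrightarrow> halts_silently sB b"
    and start: "R a b"
  shows "same_stream (\<lambda>n. concat (map e (grun sA n a))) (\<lambda>n. grun sB n b)"
proof -
  have step: "\<exists>n b'. reachn sB (Suc n) b (concat (map e w)) b' \<and> R a' b'"
    if "R a b" "sA a = Some (a', w)" for a b a' w
    using sim_step[OF that] unfolding reach_def by (metis reachn.step)
  have 1: "\<exists>m. prefix (concat (map e (grun sA n a))) (grun sB m b)" if "R a b" for n a b
    using that
  proof (induction n arbitrary: a b)
    case (Suc n)
    show ?case
    proof (cases "sA a")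
      case (Some aw)
      obtain a' w where aw: "aw = (a', w)" by fastforce
      obtain k b' where k: "reachn sB (Suc k) b (concat (map e w)) b'" "R a' b'"
        using step Suc.prems Some aw by blast
      obtain m where "prefix (concat (map e (grun sA n a'))) (grun sB m b')"
        using Suc.IH k(2) by blast
      then have "prefix (concat (map e (grun sA (Suc n) a))) (grun sB (Suc k + m) b)"
        using Some aw grun_reachn[OF k(1)] by simp
      then show ?thesis by blast
    qed simp
  qed simp
  have 2: "\<exists>m. prefix (grun sB n b) (concat (map e (grun sA m a)))" if "R a b" for n a b
    using that
  proof (induction n arbitrary: a b rule: less_induct)
    case (less n)
    show ?case
    proof (cases "sA a")
      case None
      obtain k b' where k: "reachn sB k b [] b'" "sB b' = None"
        using sim_halt[OF less.prems None] unfolding halts_silently_def reach_def by blast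
      \<comment> \<open>More steps only extend the output, and \<open>k\<close> silent steps lead to
        a stuck configuration; so the first \<open>n\<close> steps cannot have written
        anything.\<close>
      have "prefix (grun sB n b) (grun sB (k + n) b)"
        by (simp add: grun_mono')
      then have "grun sB n b = []"
        by (simp add: grun_reachn[OF k(1)] grun_stuck k(2))
      then show ?thesis by simp
    next
      case (Some aw)
      obtain a' w where aw: "aw = (a', w)" by fastforce
      obtain k b' where k: "reachn sB (Suc k) b (concat (map e w)) b'" "R a' b'"
        using step less.prems Some aw by blast
      show ?thesis
      \<comment> \<open>Either the \<open>n\<close> steps end within the round that simulates the
        current step, and the output is a prefix of the output of that round, or the whole round is
        cut off, which makes \<open>n\<close> smaller.\<close>
      proof (cases "n \<le> Suc k")
        case True
        have "prefix (grun sB n b) (grun sB (Suc k + 0) b)"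
          by (rule grun_mono') (use True in simp)
        then have "prefix (grun sB n b) (concat (map e w))"
          using grun_reachn[OF k(1), of 0] by simp
        then have "prefix (grun sB n b) (concat (map e (grun sA 1 a)))"
          using Some aw by simp
        then show ?thesis by blast
      next
        case False
        then have "n - Suc k < n" by simp
        then obtain m where m: "prefix (grun sB (n - Suc k) b') (concat (map e (grun sA m a')))"
          using less.IH k(2) by blast
        have "grun sB n b = concat (map e w) @ grun sB (n - Suc k) b'"
          using grun_reachn[OF k(1), of "n - Suc k"] False by simp
        then have "prefix (grun sB n b) (concat (map e (grun sA (Suc m) a)))"
          using Some aw m by simp
        then show ?thesis by blast
      qed
    qed
  qed
  show ?thesis
    unfolding same_stream_def using 1 2 start by blast
qed

lemma same_stream_trans: "same_stream f g \<Longrightarrow> same_stream g h \<Longrightarrow> same_stream f h"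
  unfolding same_stream_def by (meson prefix_order.trans)

text \<open>Allows for a silent start-up phase, in which the first code is loaded.\<close>

lemma same_stream_reach:
  assumes "same_stream f (\<lambda>n. grun st n b)" and "reach st a [] b"
  shows "same_stream f (\<lambda>n. grun st n a)"
proof -
  obtain m where m: "reachn st m a [] b" using assms(2) unfolding reach_def by blast
  have "\<exists>k. prefix (grun st n b) (grun st k a)" for n
    using grun_reachn[OF m, of n] by (metis append_Nil prefix_order.refl)
  moreover have "\<exists>k. prefix (grun st n a) (grun st k b)" for n
    using grun_reachn[OF m, of n] grun_mono'[of n "m + n" st a] by auto
  ultimately have "same_stream (\<lambda>n. grun st n b) (\<lambda>n. grun st n a)"
    unfolding same_stream_def by blast
  with assms(1) show ?thesis by (rule same_stream_trans)
qed

section \<open>Stack machines on a single tape\<close>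

datatype 'l instr =
    IPush nat nat 'l
  | IPop nat "nat \<Rightarrow> 'l"   \<comment> \<open>0 stands for the empty stack\<close>
  | IGoto 'l
  | IRead "nat \<Rightarrow> 'l"
  | IEmit nat 'l
  | IHalt

type_synonym store = "nat \<Rightarrow> nat list"

fun sstep :: "('l \<Rightarrow> 'l instr) \<Rightarrow> (nat \<Rightarrow> nat) \<Rightarrow> 'l \<times> store \<times> nat \<Rightarrow>
    (('l \<times> store \<times> nat) \<times> nat list) option" where
  "sstep P y (l, s, p) =
    (case P l of
       IPush r a l' \<Rightarrow> Some ((l', s(r := a # s r), p), [])
     | IPop r g \<Rightarrow>
         Some ((case s r of [] \<Rightarrow> (g 0, s, p) | a # as \<Rightarrow> (g a, s(r := as), p)), [])
     | IGoto l' \<Rightarrow> Some ((l', s, p), [])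
     | IRead g \<Rightarrow> Some ((g (y p), s, Suc p), [])
     | IEmit a l' \<Rightarrow> Some ((l', s, p), [a])
     | IHalt \<Rightarrow> None)"

text \<open>Closure of the label set under execution. A pushed symbol is at least 1 because 0 marks
  a vacant track, whereas the branches of a pop include 0 for the empty stack. Reading needs only
  the two symbols of the encoded input stream.\<close>

definition instr_ok :: "nat \<Rightarrow> nat \<Rightarrow> 'l set \<Rightarrow> 'l instr \<Rightarrow> bool" where
  "instr_ok K m L i =
    (case i of
       IPush r a l' \<Rightarrow> r < K \<and> 1 \<le> a \<and> a \<le> m \<and> l' \<in> L
     | IPop r g \<Rightarrow> r < K \<and> (\<forall>a\<le>m. g a \<in> L)
     | IGoto l' \<Rightarrow> l' \<in> L
     | IRead g \<Rightarrow> g 1 \<in> L \<and> g 2 \<in> L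
     | IEmit a l' \<Rightarrow> a \<in> {1, 2} \<and> l' \<in> L
     | IHalt \<Rightarrow> True)"

text \<open>A tape cell is a tuple with one entry per track. Entries beyond track \<open>K\<close>
  are fixed to 0, so that there are finitely many cells.\<close>

definition cells :: "nat \<Rightarrow> nat \<Rightarrow> (nat \<Rightarrow> nat) set" where
  "cells K m = {c. (\<forall>r. c r \<le> m) \<and> (\<forall>r\<ge>K. c r = 0)}"

definition blank :: "nat \<Rightarrow> nat" where "blank = (\<lambda>_. 0)"

lemma finite_cells: "finite (cells K m)"
proof -
  have "cells K m \<subseteq> {f. \<forall>x. (x \<in> {..<K} \<longrightarrow> f x \<in> {..m}) \<and> (x \<notin> {..<K} \<longrightarrow> f x = 0)}"
    unfolding cells_def by auto
  then show ?thesis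
    by (rule finite_subset) (rule finite_set_of_finite_funs; simp)
qed

lemma blank_in_cells: "blank \<in> cells K m"
  unfolding blank_def cells_def by simp

text \<open>Stack \<open>r\<close> is stored on track \<open>r\<close> of the cells 0, 1, 2, ..., its top being the
  rightmost occupied cell; hence the cells to the left of a cell that is occupied on
  some track are all non-blank, and cell -1 is blank.\<close>

definition cell :: "store \<Rightarrow> int \<Rightarrow> nat \<Rightarrow> nat" where
  "cell s z r = (if 0 \<le> z \<and> nat z < length (s r) then rev (s r) ! nat z else 0)"

definition store_ok :: "nat \<Rightarrow> nat \<Rightarrow> store \<Rightarrow> bool" where
  "store_ok K m s \<longleftrightarrow> (\<forall>r. set (s r) \<subseteq> {1..m}) \<and> (\<forall>r\<ge>K. s r = [])"

lemma cell_in_cells: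
  assumes "store_ok K m s" shows "cell s z \<in> cells K m"
proof -
  have "rev (s r) ! nat z \<le> m" if "nat z < length (s r)" for r
  proof -
    have "rev (s r) ! nat z \<in> set (s r)" using that by (metis length_rev nth_mem set_rev)
    then show ?thesis using assms unfolding store_ok_def by fastforce
  qed
  then show ?thesis using assms unfolding cells_def cell_def store_ok_def by auto
qed

lemma cell_pos:
  assumes "store_ok K m s" "0 \<le> z" "nat z < length (s r)" shows "cell s z r > 0"
proof -
  have "rev (s r) ! nat z \<in> set (s r)" using assms(3) by (metis length_rev nth_mem set_rev)
  then show ?thesis using assms unfolding store_ok_def cell_def by fastforce
qed

lemma cell_neg: "cell s (- 1) = blank"
  unfolding cell_def blank_def by auto

lemma cell_push: "(cell s)(int (length (s r)) := (cell s (int (length (s r))))(r := a))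
    = cell (s(r := a # s r))"
  by (intro ext) (auto simp: cell_def nth_append)

lemma cell_pop: "s r = a # as \<Longrightarrow>
    (cell s)(int (length as) := (cell s (int (length as)))(r := 0)) = cell (s(r := as))"
  by (intro ext) (auto simp: cell_def nth_append)

lemma cell_top: "s r = a # as \<Longrightarrow> cell s (int (length as)) r = a"
  by (auto simp: cell_def nth_append)

lemma cell_len: "cell s (int (length (s r))) r = 0"
  by (auto simp: cell_def)

text \<open>Phase 0 executes an instruction, scanning to the right for the end of a stack if
  necessary; phase 1 takes the top symbol of a stack; phase 2 returns to cell 0.\<close>

definition act :: "('l \<Rightarrow> 'l instr) \<Rightarrow> ('l \<times> nat \<Rightarrow> nat) \<Rightarrow> ((nat \<Rightarrow> nat) \<Rightarrow> nat) \<Rightarrow>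
    'l \<times> nat \<Rightarrow> (nat \<Rightarrow> nat) \<Rightarrow> itm_act option" where
  "act P hs hc = (\<lambda>(l, ph) c.
     if ph = 2 then
       (if c = blank then Some (Work (hs (l, 0)) (hc c) Right)
        else Some (Work (hs (l, 2)) (hc c) Left))
     else if ph = 1 then
       (case P l of
          IPop r g \<Rightarrow> (if c r = 0 then Some (Work (hs (g 0, 0)) (hc c) Right)
                     else Some (Work (hs (g (c r), 2)) (hc (c(r := 0))) Left))
        | _ \<Rightarrow> None)
     else
       (case P l of
          IPush r a l' \<Rightarrow> (if c r = 0 then Some (Work (hs (l', 2)) (hc (c(r := a))) Left)
                     else Some (Work (hs (l, 0)) (hc c) Right))
        | IPop r g \<Rightarrow> (if c r = 0 then Some (Work (hs (l, 1)) (hc c) Left)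
                     else Some (Work (hs (l, 0)) (hc c) Right))
        | IGoto l' \<Rightarrow> Some (Work (hs (l', 2)) (hc c) Left)
        | IRead g \<Rightarrow> Some (Read (\<lambda>y. hs (g y, 0)))
        | IEmit a l' \<Rightarrow> Some (Emit a (hs (l', 0)))
        | IHalt \<Rightarrow> None))"

text \<open>Any injective numbering of control states and cells will do, except that the blank cell
  must get the number 0, as the machine starts on a tape of zeros.\<close>

locale stack_machine =
  fixes P :: "'l \<Rightarrow> 'l instr" and L :: "'l set" and K m :: nat and l0 :: 'l
    and hs :: "'l \<times> nat \<Rightarrow> nat" and hc :: "(nat \<Rightarrow> nat) \<Rightarrow> nat"
  assumes fin: "finite L" and start: "l0 \<in> L"
    and ok: "l \<in> L \<Longrightarrow> instr_ok K m L (P l)"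
    and hs: "inj_on hs (L \<times> {0, 1, 2})" and hc: "inj_on hc (cells K m)" "hc blank = 0"
begin

definition tm :: itm where
  "tm = \<lparr>i_states = hs ` (L \<times> {0, 1, 2}), i_start = hs (l0, 0), i_tapealph = hc ` cells K m,
     i_inalph = {1, 2}, i_outalph = {1, 2},
     i_delta = (\<lambda>q a. act P hs hc (inv_into (L \<times> {0, 1, 2}) hs q) (inv_into (cells K m) hc a))\<rparr>"

lemma tm_fields:
  "i_states tm = hs ` (L \<times> {0, 1, 2})" "i_start tm = hs (l0, 0)"
  "i_tapealph tm = hc ` cells K m" "i_inalph tm = {1, 2}" "i_outalph tm = {1, 2}"
  by (simp_all add: tm_def)

lemma delta_tm:
  assumes "l \<in> L" "ph \<in> {0, 1, 2}" "c \<in> cells K m"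
  shows "i_delta tm (hs (l, ph)) (hc c) = act P hs hc (l, ph) c"
  using assms hs hc by (simp add: tm_def)

lemma cells_upd: "c \<in> cells K m \<Longrightarrow> r < K \<Longrightarrow> a \<le> m \<Longrightarrow> c(r := a) \<in> cells K m"
  unfolding cells_def by auto

lemma wf_tm: "wf_itm tm"
proof -
  have "case act P hs hc (l, ph) c of None \<Rightarrow> True
      | Some (Work q' b d) \<Rightarrow> q' \<in> hs ` (L \<times> {0, 1, 2}) \<and> b \<in> hc ` cells K m
      | Some (Read f) \<Rightarrow> (\<forall>c \<in> {1, 2}. f c \<in> hs ` (L \<times> {0, 1, 2}))
      | Some (Emit c q') \<Rightarrow> c \<in> {1, 2} \<and> q' \<in> hs ` (L \<times> {0, 1, 2})"
    if "l \<in> L" "ph \<in> {0, 1, 2}" "c \<in> cells K m" for l ph c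
  proof -
    have "c r \<le> m" for r using that unfolding cells_def by auto
    with that ok[of l] cells_upd show ?thesis
      by (auto simp: act_def instr_ok_def split: instr.splits)
  qed
  then have "case i_delta tm (hs (l, ph)) (hc c) of None \<Rightarrow> True
      | Some (Work q' b d) \<Rightarrow> q' \<in> i_states tm \<and> b \<in> i_tapealph tm
      | Some (Read f) \<Rightarrow> (\<forall>c \<in> i_inalph tm. f c \<in> i_states tm)
      | Some (Emit c q') \<Rightarrow> c \<in> i_outalph tm \<and> q' \<in> i_states tm"
    if "l \<in> L" "ph \<in> {0, 1, 2}" "c \<in> cells K m" for l ph c
    unfolding delta_tm[OF that] using that by (simp only: tm_fields)
  moreover have "0 \<in> i_tapealph tm"
    unfolding tm_fields using hc(2) blank_in_cells by (metis image_eqI)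
  ultimately show ?thesis
    unfolding wf_itm_def using fin start finite_cells by (auto simp: tm_fields simp del: insert_iff)
qed

definition tcfg :: "'l \<Rightarrow> nat \<Rightarrow> store \<Rightarrow> int \<Rightarrow> nat \<Rightarrow> icfg" where
  "tcfg l ph s z p = \<lparr>ist = hs (l, ph), itape = (\<lambda>z. hc (cell s z)), ihd = z, ipos = p\<rparr>"

lemma istep_tcfg:
  assumes "l \<in> L" "ph \<in> {0, 1, 2}" "store_ok K m s"
  shows "istep tm y (tcfg l ph s z p) =
    (case act P hs hc (l, ph) (cell s z) of
       None \<Rightarrow> None
     | Some (Work q' b d) \<Rightarrow>
         Some (\<lparr>ist = q', itape = (\<lambda>z. hc (cell s z))(z := b), ihd = imove d z, ipos = p\<rparr>, [])
     | Some (Read f) \<Rightarrow> Some ((tcfg l ph s z p)\<lparr>ist := f (y p), ipos := Suc p\<rparr>, [])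
     | Some (Emit a q') \<Rightarrow> Some ((tcfg l ph s z p)\<lparr>ist := q'\<rparr>, [a]))"
  using delta_tm[OF assms(1,2) cell_in_cells[OF assms(3)], of z]
  by (simp add: istep_def tcfg_def split: option.splits itm_act.splits)

lemma istep_stay:
  assumes "l \<in> L" "ph \<in> {0, 1, 2}" "store_ok K m s"
    and "act P hs hc (l, ph) (cell s z) = Some (Work (hs (l', ph')) (hc (cell s z)) d)"
  shows "istep tm y (tcfg l ph s z p) = Some (tcfg l' ph' s (imove d z) p, [])"
  using assms istep_tcfg[OF assms(1-3)] by (simp add: tcfg_def fun_upd_idem)

text \<open>The blank cell -1 serves as the left end marker: the head walks left over non-blank
  cells until it meets it and then makes one step to the right. For \<open>j = 0\<close> the head is
  already there.\<close>

lemma reach_return: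
  assumes "l \<in> L" "store_ok K m s" "\<And>i. 0 \<le> i \<Longrightarrow> i < int j \<Longrightarrow> cell s i \<noteq> blank"
  shows "reach (istep tm y) (tcfg l 2 s (int j - 1) p) [] (tcfg l 0 s 0 p)"
  using assms(3)
proof (induction j)
  case 0
  have "istep tm y (tcfg l 2 s (- 1) p) = Some (tcfg l 0 s (imove Right (- 1)) p, [])"
    by (rule istep_stay) (use assms in \<open>auto simp: act_def cell_neg\<close>)
  then show ?case by (auto intro: reach_step_silent reach_refl)
next
  case (Suc j)
  have "cell s (int j) \<noteq> blank" using Suc.prems by simp
  then have "istep tm y (tcfg l 2 s (int j) p) = Some (tcfg l 2 s (imove Left (int j)) p, [])"
    by (intro istep_stay) (use assms in \<open>auto simp: act_def\<close>)
  with Suc show ?case by (auto intro: reach_step_silent)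
qed

lemma reach_scan:
  assumes "l \<in> L" "store_ok K m s"
    and "(\<exists>a l'. P l = IPush r a l') \<or> (\<exists>g. P l = IPop r g)"
    and "j \<le> length (s r)"
  shows "reach (istep tm y) (tcfg l 0 s (int j) p) [] (tcfg l 0 s (int (length (s r))) p)"
  using assms(4)
proof (induction j rule: inc_induct)
  case base
  show ?case by (rule reach_refl)
next
  case (step j)
  have "cell s (int j) r > 0" using cell_pos assms step by simp
  then have "istep tm y (tcfg l 0 s (int j) p) = Some (tcfg l 0 s (imove Right (int j)) p, [])"
    by (intro istep_stay) (use assms in \<open>auto simp: act_def\<close>)
  with step show ?case by (auto intro: reach_step_silent simp: add.commute)
qed


definition sim :: "'l \<times> store \<times> nat \<Rightarrow> icfg \<Rightarrow> bool" where
  "sim c ic \<longleftrightarrow> (case c of (l, s, p) \<Rightarrow> l \<in> L \<and> store_ok K m s \<and> ic = tcfg l 0 s 0 p)"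

lemma store_ok_push:
  "store_ok K m s \<Longrightarrow> r < K \<Longrightarrow> 1 \<le> a \<Longrightarrow> a \<le> m \<Longrightarrow> store_ok K m (s(r := a # s r))"
  unfolding store_ok_def by auto

lemma store_ok_pop: "store_ok K m s \<Longrightarrow> s r = a # as \<Longrightarrow> store_ok K m (s(r := as))"
  unfolding store_ok_def by (metis empty_subsetI fun_upd_apply list.set(1) list.simps(3) set_subset_Cons subset_trans)

lemma occupied:
  assumes "store_ok K m s" "0 \<le> i" "i < int (length (s r))"
  shows "cell s i \<noteq> blank"
proof -
  have "nat i < length (s r)" using assms(2,3) by linarith
  then have "cell s i r > 0" using cell_pos[OF assms(1,2)] by blast
  then show ?thesis by (auto simp: blank_def)
qed

text \<open>One instruction costs a round trip from cell 0 to the end of a stack and back. The first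
  machine step is displayed separately, as \<open>simulation_same_stream\<close> requires; this is
  why an empty stack, where the scan has no step of its own, is a separate case.\<close>

lemma sim_step:
  assumes y: "\<And>n. y n \<in> {1, 2}"
    and sim: "sim (l, s, p) b" and st: "sstep P y (l, s, p) = Some (a', w)"
  shows "\<exists>b1 w1 w2 b'. istep tm y b = Some (b1, w1) \<and> reach (istep tm y) b1 w2 b' \<and>
      w1 @ w2 = w \<and> sim a' b'"
proof -
  have l: "l \<in> L" and s: "store_ok K m s" and b: "b = tcfg l 0 s 0 p"
    using sim by (auto simp: sim_def)
  note ok = ok[OF l, unfolded instr_ok_def]
  note stp = istep_tcfg[OF l _ s]
  have silent: ?thesis if "istep tm y b = Some (b1, [])" "reach (istep tm y) b1 [] b'"
    "w = []" "sim a' b'" for b1 b'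
    using that by (intro exI[of _ b1] exI[of _ b'] exI[of _ "[]"]) simp
  show ?thesis
  proof (cases "P l")
    case (IPush r a l')
    let ?s = "s(r := a # s r)" and ?n = "int (length (s r))"
    have o: "r < K" "1 \<le> a" "a \<le> m" "l' \<in> L" using ok IPush by auto
    have s': "store_ok K m ?s" using store_ok_push s o by blast
    have e: "istep tm y (tcfg l 0 s ?n p) = Some (tcfg l' 2 ?s (?n - 1) p, [])"
      using stp[of 0 y ?n p] IPush
      by (simp add: act_def cell_len tcfg_def cell_push[symmetric] fun_eq_iff)
    have ret: "reach (istep tm y) (tcfg l' 2 ?s (?n - 1) p) [] (tcfg l' 0 ?s 0 p)"
    proof (rule reach_return[OF o(4) s'])
      fix i assume "0 \<le> i" "i < ?n"
      then show "cell ?s i \<noteq> blank" by (intro occupied[OF s', of i r]) auto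
    qed
    then have r1: "reach (istep tm y) (tcfg l 0 s ?n p) [] (tcfg l' 0 ?s 0 p)"
      by (rule reach_step_silent[where st = "istep tm y", OF e])
    show ?thesis
    proof (cases "s r")
      case Nil
      then have "istep tm y b = Some (tcfg l' 2 ?s (?n - 1) p, [])" using e b by simp
      then show ?thesis
        by (rule silent[OF _ ret]) (use IPush st o s' in \<open>auto simp: sim_def\<close>)
    next
      case Cons
      then have "istep tm y b = Some (tcfg l 0 s 1 p, [])"
        using cell_pos[OF s, of 0 r] IPush l s b istep_stay[of l 0 s 0 l 0 Right y p]
        by (auto simp: act_def)
      moreover have "reach (istep tm y) (tcfg l 0 s 1 p) [] (tcfg l 0 s ?n p)"
        using reach_scan[OF l s, of r 1 y p] IPush Cons by auto
      ultimately show ?thesis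
        by (rule silent[OF _ reach_trans_silent[OF _ r1]]) (use IPush st o s' in \<open>auto simp: sim_def\<close>)
    qed
  next
    case (IPop r g)
    let ?n = "int (length (s r))"
    have o: "r < K" "\<And>a. a \<le> m \<Longrightarrow> g a \<in> L" using ok IPop by auto
    have e: "istep tm y (tcfg l 0 s ?n p) = Some (tcfg l 1 s (?n - 1) p, [])"
      using istep_stay[of l 0 s ?n l 1 Left y p] IPop l s by (auto simp: act_def cell_len)
    show ?thesis
    proof (cases "s r")
      case Nil
      \<comment> \<open>On an empty stack phase 1 looks at cell -1; finding a vacant track there is
        the emptiness test.\<close>
      have "istep tm y (tcfg l 1 s (- 1) p) = Some (tcfg (g 0) 0 s (imove Right (- 1)) p, [])"
        by (rule istep_stay) (use l s IPop in \<open>auto simp: act_def cell_neg blank_def\<close>)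
      then have "reach (istep tm y) (tcfg l 1 s (- 1) p) [] (tcfg (g 0) 0 s 0 p)"
        by (auto intro: reach_step_silent reach_refl)
      moreover have "istep tm y b = Some (tcfg l 1 s (- 1) p, [])" using e b Nil by simp
      ultimately show ?thesis
        by (intro silent[of "tcfg l 1 s (- 1) p"]) (use IPop st Nil o s in \<open>auto simp: sim_def\<close>)
    next
      case (Cons a as)
      let ?s = "s(r := as)"
      have "a \<in> {1..m}" using s Cons unfolding store_ok_def by (metis list.set_intros(1) subsetD)
      then have a: "a \<noteq> 0" "a \<le> m" by auto
      have s': "store_ok K m ?s" using store_ok_pop s Cons by blast
      have n: "?n - 1 = int (length as)" using Cons by simp
      have e2: "istep tm y (tcfg l 1 s (int (length as)) p)
          = Some (tcfg (g a) 2 ?s (int (length as) - 1) p, [])"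
        using stp[of 1 y "int (length as)" p] IPop a cell_top[of s r, OF Cons]
        by (simp add: act_def tcfg_def cell_pop[of s r, OF Cons, symmetric] fun_eq_iff)
      have "reach (istep tm y) (tcfg (g a) 2 ?s (int (length as) - 1) p) [] (tcfg (g a) 0 ?s 0 p)"
      proof (rule reach_return[OF o(2)[OF a(2)] s'])
        fix i assume "0 \<le> i" "i < int (length as)"
        then show "cell ?s i \<noteq> blank" by (intro occupied[OF s', of i r]) auto
      qed
      then have "reach (istep tm y) (tcfg l 1 s (int (length as)) p) [] (tcfg (g a) 0 ?s 0 p)"
        by (rule reach_step_silent[where st = "istep tm y", OF e2])
      then have r1: "reach (istep tm y) (tcfg l 0 s ?n p) [] (tcfg (g a) 0 ?s 0 p)"
        using reach_step_silent[where st = "istep tm y", OF e] n by simp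
      have "istep tm y b = Some (tcfg l 0 s 1 p, [])"
        using cell_pos[OF s, of 0 r] IPop l s b Cons istep_stay[of l 0 s 0 l 0 Right y p]
        by (auto simp: act_def)
      moreover have "reach (istep tm y) (tcfg l 0 s 1 p) [] (tcfg l 0 s ?n p)"
        using reach_scan[OF l s, of r 1 y p] IPop Cons by auto
      ultimately show ?thesis
        by (rule silent[OF _ reach_trans_silent[OF _ r1]])
          (use IPop st o s' a Cons in \<open>auto simp: sim_def\<close>)
    qed
  next
    case (IGoto l')
    \<comment> \<open>A \<open>Work\<close> action must move the head, so a mere jump steps to cell
      -1 and lets phase 2 return.\<close>
    have "istep tm y b = Some (tcfg l' 2 s (- 1) p, [])"
      using istep_stay[of l 0 s 0 l' 2 Left y p] IGoto l s b by (auto simp: act_def)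
    moreover have "l' \<in> L" using ok IGoto by auto
    ultimately show ?thesis
      using reach_return[of l' s 0 y p] s IGoto st
      by (intro silent[of "tcfg l' 2 s (- 1) p" "tcfg l' 0 s 0 p"]) (auto simp: sim_def)
  next
    case (IRead g)
    then have "istep tm y b = Some (tcfg (g (y p)) 0 s 0 (Suc p), [])"
      using stp[of 0 y 0 p] b by (simp add: act_def tcfg_def)
    moreover have "g (y p) \<in> L" using ok IRead y[of p] by auto
    ultimately show ?thesis using IRead st s
      by (auto simp: sim_def intro!: reach_refl)
  next
    case (IEmit a l')
    then have "istep tm y b = Some (tcfg l' 0 s 0 p, [a])"
      using stp[of 0 y 0 p] b by (simp add: act_def tcfg_def)
    moreover have "l' \<in> L" using ok IEmit by auto
    ultimately show ?thesis using IEmit st s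
      by (auto simp: sim_def intro!: reach_refl exI[of _ "[]"])
  next
    case IHalt
    then show ?thesis using st by simp
  qed
qed

lemma tm_same_stream:
  assumes y: "\<And>n. y n \<in> {1, 2}"
  shows "same_stream (\<lambda>n. grun (sstep P y) n (l0, \<lambda>_. [], 0)) (\<lambda>n. grun (istep tm y) n (iinit tm))"
proof -
  have "same_stream (\<lambda>n. concat (map (\<lambda>a. [a]) (grun (sstep P y) n (l0, \<lambda>_. [], 0))))
      (\<lambda>n. grun (istep tm y) n (iinit tm))"
  proof (rule simulation_same_stream[where R = sim])
    fix a b a' w
    assume "sim a b" "sstep P y a = Some (a', w)"
    then show "\<exists>b1 w1 w2 b'. istep tm y b = Some (b1, w1) \<and> reach (istep tm y) b1 w2 b' \<and>
        w1 @ w2 = concat (map (\<lambda>a. [a]) w) \<and> sim a' b'"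
      using sim_step[OF y] by (cases a) simp
  next
    fix a b
    assume *: "sim a b" "sstep P y a = None"
    obtain l s p where a: "a = (l, s, p)" by (cases a)
    have "istep tm y b = None"
      using * a istep_tcfg[of l 0 s y 0 p]
      by (auto simp: sim_def act_def split: instr.splits)
    then show "halts_silently (istep tm y) b" by (rule halts_silently_stuck)
  next
    have "cell (\<lambda>_. []) = (\<lambda>_. blank)" by (auto simp: cell_def blank_def fun_eq_iff)
    then show "sim (l0, \<lambda>_. [], 0) (iinit tm)"
      using hc(2) start by (simp add: sim_def tcfg_def iinit_def tm_fields store_ok_def)
  qed
  then show ?thesis by simp
qed

end

lemma stack_machine_itm:
  fixes P :: "'l \<Rightarrow> 'l instr"
  assumes "finite L" "l0 \<in> L" "\<And>l. l \<in> L \<Longrightarrow> instr_ok K m L (P l)"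
  shows "\<exists>M. wf_itm M \<and> i_inalph M = {1, 2} \<and> i_outalph M = {1, 2} \<and>
    (\<forall>y. (\<forall>n. y n \<in> {1, 2}) \<longrightarrow>
      same_stream (\<lambda>n. grun (sstep P y) n (l0, \<lambda>_. [], 0)) (\<lambda>n. irun M y n (iinit M)))"
proof -
  have "finite (L \<times> {0, 1, 2 :: nat})" using assms(1) by simp
  then obtain hs :: "'l \<times> nat \<Rightarrow> nat" where hs: "inj_on hs (L \<times> {0, 1, 2})"
    using finite_imp_inj_to_nat_seg by blast
  obtain h :: "(nat \<Rightarrow> nat) \<Rightarrow> nat" where h: "inj_on h (cells K m)"
    using finite_imp_inj_to_nat_seg[OF finite_cells] by blast
  \<comment> \<open>The shift by one keeps the number 0 free for the blank cell.\<close>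
  define hc where "hc c = (if c = blank then 0 else Suc (h c))" for c
  have hc: "inj_on hc (cells K m)" "hc blank = 0"
    using h by (auto simp: hc_def inj_on_def)
  interpret stack_machine P L K m l0 hs hc
    by unfold_locales (use assms hs hc in auto)
  show ?thesis
    by (rule exI[of _ tm]) (use wf_tm tm_same_stream in \<open>auto simp: tm_fields irun_eq_grun\<close>)
qed

section \<open>A structured language for stack machines\<close>

datatype com =
    Skip
  | Push nat nat
  | Case nat "nat \<Rightarrow> com"   \<comment> \<open>pops and branches; 0 stands for the empty stack\<close>
  | For nat "nat \<Rightarrow> com"    \<comment> \<open>pops until the stack is empty\<close>
  | Seq com com  (infixr ";;" 60)
  | Input nat
  | Output nat
  | Abort
  | Forever com

text \<open>The label of the stack machine is the list of commands still to be executed; a loop puts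
  itself back behind its body. \<open>Input\<close> consumes one whole block of
  \<open>sym_enc\<close>: it pushes a 1 for every 1 read and ends at the first other symbol.\<close>

fun decode :: "com list \<Rightarrow> com list instr" where
  "decode [] = IHalt"
| "decode (Skip # k) = IGoto k"
| "decode (Push r a # k) = IPush r a k"
| "decode (Case r f # k) = IPop r (\<lambda>a. f a # k)"
| "decode (For r f # k) = IPop r (\<lambda>a. if a = 0 then k else f a # For r f # k)"
| "decode ((a ;; b) # k) = IGoto (a # b # k)"
| "decode (Input r # k) = IRead (\<lambda>c. if c = 1 then Push r 1 # Input r # k else k)"
| "decode (Output a # k) = IEmit a k"
| "decode (Abort # k) = IHalt"
| "decode (Forever c # k) = IGoto (c # Forever c # k)"

abbreviation crun :: "(nat \<Rightarrow> nat) \<Rightarrow> com list \<times> store \<times> nat \<Rightarrow>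
    ((com list \<times> store \<times> nat) \<times> nat list) option" where
  "crun \<equiv> sstep decode"

text \<open>The continuations reachable while \<open>c\<close> is executed in front of \<open>k\<close>; as there are
  only finitely many, they can serve as control states.\<close>

primrec conts :: "nat \<Rightarrow> com \<Rightarrow> com list \<Rightarrow> com list set" where
  "conts m Skip k = {Skip # k}"
| "conts m (Push r a) k = {Push r a # k}"
| "conts m (Case r f) k = {Case r f # k} \<union> (\<Union>a\<in>{..m}. conts m (f a) k)"
| "conts m (For r f) k = {For r f # k} \<union> (\<Union>a\<in>{1..m}. conts m (f a) (For r f # k))"
| "conts m (a ;; b) k = {(a ;; b) # k} \<union> conts m a (b # k) \<union> conts m b k"
| "conts m (Input r) k = {Input r # k, Push r 1 # Input r # k}"
| "conts m (Output a) k = {Output a # k}"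
| "conts m Abort k = {Abort # k}"
| "conts m (Forever c) k = {Forever c # k} \<union> conts m c (Forever c # k)"

primrec preserves :: "nat \<Rightarrow> com \<Rightarrow> bool" where
  "preserves r Skip \<longleftrightarrow> True"
| "preserves r (Push r' a) \<longleftrightarrow> r \<noteq> r'"
| "preserves r (Case r' f) \<longleftrightarrow> r \<noteq> r' \<and> (\<forall>a. preserves r (f a))"
| "preserves r (For r' f) \<longleftrightarrow> r \<noteq> r' \<and> (\<forall>a. preserves r (f a))"
| "preserves r (a ;; b) \<longleftrightarrow> preserves r a \<and> preserves r b"
| "preserves r (Input r') \<longleftrightarrow> r \<noteq> r'"
| "preserves r (Output a) \<longleftrightarrow> True"
| "preserves r Abort \<longleftrightarrow> True"
| "preserves r (Forever c) \<longleftrightarrow> preserves r c"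

primrec wf_com :: "nat \<Rightarrow> nat \<Rightarrow> com \<Rightarrow> bool" where
  "wf_com K m Skip \<longleftrightarrow> True"
| "wf_com K m (Push r a) \<longleftrightarrow> r < K \<and> 1 \<le> a \<and> a \<le> m"
| "wf_com K m (Case r f) \<longleftrightarrow> r < K \<and> (\<forall>a\<le>m. wf_com K m (f a))"
| "wf_com K m (For r f) \<longleftrightarrow> r < K \<and> (\<forall>a\<in>{1..m}. wf_com K m (f a))"
| "wf_com K m (a ;; b) \<longleftrightarrow> wf_com K m a \<and> wf_com K m b"
| "wf_com K m (Input r) \<longleftrightarrow> r < K \<and> 1 \<le> m"
| "wf_com K m (Output a) \<longleftrightarrow> a \<in> {1, 2}"
| "wf_com K m Abort \<longleftrightarrow> True"
| "wf_com K m (Forever c) \<longleftrightarrow> wf_com K m c"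

lemma finite_conts: "finite (conts m c k)"
  by (induction c arbitrary: k) auto

lemma self_in_conts: "c # k \<in> conts m c k"
  by (cases c) auto

lemma instr_ok_mono: "instr_ok K m L i \<Longrightarrow> L \<subseteq> L' \<Longrightarrow> instr_ok K m L' i"
  by (auto simp: instr_ok_def split: instr.splits)

text \<open>The induction needs arbitrary \<open>k\<close>, since a subprogram runs in front of a
  different continuation, a loop body for instance in front of its loop. \<open>k\<close> itself is
  inserted because control passes to it when \<open>c\<close> ends.\<close>

lemma conts_closed:
  assumes "wf_com K m c" "l \<in> conts m c k"
  shows "instr_ok K m (insert k (conts m c k)) (decode l)"
  using assms
proof (induction c arbitrary: k l)
  case (Case r f)
  show ?case
  proof (cases "l = Case r f # k")
    case True
    then show ?thesis using Case self_in_conts by (auto simp: instr_ok_def) blast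
  next
    case False
    then obtain a where a: "a \<le> m" "l \<in> conts m (f a) k" using Case.prems by auto
    then have "instr_ok K m (insert k (conts m (f a) k)) (decode l)" using Case by auto
    then show ?thesis by (rule instr_ok_mono) (use a in auto)
  qed
next
  case (For r f)
  show ?case
  proof (cases "l = For r f # k")
    case True
    have "f a # For r f # k \<in> conts m (For r f) k" if "a \<noteq> 0" "a \<le> m" for a
      using that self_in_conts[of "f a" "For r f # k" m] by fastforce
    then show ?thesis using True For.prems by (auto simp: instr_ok_def)
  next
    case False
    then obtain a where a: "a \<in> {1..m}" "l \<in> conts m (f a) (For r f # k)" using For.prems by auto
    then have "instr_ok K m (insert (For r f # k) (conts m (f a) (For r f # k))) (decode l)"
      using For by auto
    then show ?thesis by (rule instr_ok_mono) (use a in auto)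
  qed
next
  case (Seq c1 c2)
  have "instr_ok K m (insert (c2 # k) (conts m c1 (c2 # k))) (decode l)"
    if "l \<in> conts m c1 (c2 # k)" using that Seq by auto
  moreover have "instr_ok K m (insert k (conts m c2 k)) (decode l)"
    if "l \<in> conts m c2 k" using that Seq by auto
  moreover have "instr_ok K m (conts m c1 (c2 # k)) (IGoto (c1 # c2 # k))"
    by (simp add: instr_ok_def self_in_conts)
  ultimately show ?case using Seq.prems self_in_conts[of c2 k m]
    by (auto elim!: instr_ok_mono)
next
  case (Forever c)
  have "instr_ok K m (insert (Forever c # k) (conts m c (Forever c # k))) (decode l)"
    if "l \<in> conts m c (Forever c # k)" using that Forever by auto
  moreover have "instr_ok K m (conts m c (Forever c # k)) (IGoto (c # Forever c # k))"
    by (simp add: instr_ok_def self_in_conts)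
  ultimately show ?case using Forever.prems
    by (auto elim!: instr_ok_mono)
qed (auto simp: instr_ok_def)

lemma com_itm:
  assumes "wf_com K m c"
  shows "\<exists>M. wf_itm M \<and> i_inalph M = {1, 2} \<and> i_outalph M = {1, 2} \<and>
    (\<forall>y. (\<forall>n. y n \<in> {1, 2}) \<longrightarrow>
      same_stream (\<lambda>n. grun (crun y) n ([c], \<lambda>_. [], 0)) (\<lambda>n. irun M y n (iinit M)))"
proof (rule stack_machine_itm[where L = "insert [] (conts m c [])" and K = K and m = m])
  show "finite (insert [] (conts m c []))" by (simp add: finite_conts)
  show "[c] \<in> insert [] (conts m c [])" by (simp add: self_in_conts)
  show "instr_ok K m (insert [] (conts m c [])) (decode l)" if "l \<in> insert [] (conts m c [])" for l
    using that conts_closed[OF assms] by (auto simp: instr_ok_def)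
qed

section \<open>Semantics of programs without input and output\<close>

primrec pure :: "com \<Rightarrow> bool" where
  "pure Skip \<longleftrightarrow> True"
| "pure (Push r a) \<longleftrightarrow> a \<noteq> 0"
| "pure (Case r f) \<longleftrightarrow> (\<forall>a. pure (f a))"
| "pure (For r f) \<longleftrightarrow> (\<forall>a. a \<noteq> 0 \<longrightarrow> pure (f a) \<and> preserves r (f a))"
| "pure (a ;; b) \<longleftrightarrow> pure a \<and> pure b"
| "pure (Input r) \<longleftrightarrow> False"
| "pure (Output a) \<longleftrightarrow> False"
| "pure Abort \<longleftrightarrow> True"
| "pure (Forever c) \<longleftrightarrow> False"

primrec floop :: "nat \<Rightarrow> (nat \<Rightarrow> store \<Rightarrow> store option) \<Rightarrow> nat list \<Rightarrow> store \<Rightarrow> store option" where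
  "floop r g [] s = Some (s(r := []))"
| "floop r g (a # as) s = Option.bind (g a (s(r := as))) (floop r g as)"

text \<open>\<^const>\<open>None\<close> means that the program aborts.  The loop is a fold over the
  initial contents of its stack, which is correct because the body of a loop in a
  \<^const>\<open>pure\<close> program does not change that stack.\<close>

primrec psem :: "com \<Rightarrow> store \<Rightarrow> store option" where
  "psem Skip s = Some s"
| "psem (Push r a) s = Some (s(r := a # s r))"
| "psem (Case r f) s = (case s r of [] \<Rightarrow> psem (f 0) s | a # as \<Rightarrow> psem (f a) (s(r := as)))"
| "psem (For r f) s = floop r (\<lambda>a. psem (f a)) (s r) s"
| "psem (a ;; b) s = Option.bind (psem a s) (psem b)"
| "psem (Input r) s = None"
| "psem (Output a) s = None"
| "psem Abort s = None"
| "psem (Forever c) s = None"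

lemma psem_preserves: "psem c s = Some s' \<Longrightarrow> preserves r c \<Longrightarrow> s' r = s r"
proof (induction c arbitrary: s s')
  case (For r' f)
  have "floop r' (\<lambda>a. psem (f a)) as s = Some s' \<Longrightarrow> s' r = s r" for as s s'
  proof (induction as arbitrary: s)
    case (Cons a as)
    then show ?case using For.IH[of "f a"] For.prems(2) by (fastforce split: bind_splits)
  qed (use For.prems in auto)
  then show ?case using For.prems by simp
next
  case (Case r' f)
  show ?case
  proof (cases "s r'")
    case Nil
    then show ?thesis using Case.prems by (intro Case.IH[of "f 0" s s']) auto
  next
    case (Cons a as)
    have "psem (f a) (s(r' := as)) = Some s'" "preserves r (f a)" "r \<noteq> r'"
      using Case.prems Cons by simp_all
    with Case.IH[OF rangeI this(1,2)] show ?thesis by simp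
  qed
next
  case (Seq c1 c2)
  then show ?case by (auto split: bind_splits) metis
qed auto

text \<open>A 0 on a stack would be mistaken for the empty stack and would end a \<open>For\<close>
  loop too early, whereas \<open>floop\<close> would go on.\<close>

definition good_store :: "store \<Rightarrow> bool" where
  "good_store s \<longleftrightarrow> (\<forall>r. 0 \<notin> set (s r))"

lemma good_store_upd: "good_store s \<Longrightarrow> 0 \<notin> set as \<Longrightarrow> good_store (s(r := as))"
  unfolding good_store_def by simp

lemma good_store_pop: "good_store s \<Longrightarrow> s r = a # as \<Longrightarrow> a \<noteq> 0 \<and> good_store (s(r := as))"
  unfolding good_store_def by (metis fun_upd_apply list.set_intros(1) list.set_intros(2))

text \<open>Treats both ends of a pure program at once: an abort must be a silent halt, and normal
  termination must reach \<open>k\<close> with the input position unchanged.\<close>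

definition outcome :: "(nat \<Rightarrow> nat) \<Rightarrow> com list \<times> store \<times> nat \<Rightarrow> com list \<Rightarrow> nat \<Rightarrow>
    store option \<Rightarrow> bool" where
  "outcome y c k p r = (case r of
      None \<Rightarrow> halts_silently (crun y) c
    | Some s' \<Rightarrow> reach (crun y) c [] (k, s', p) \<and> good_store s')"

lemma outcome_reach:
  assumes "reach (crun y) c [] c1" "outcome y c1 k p r" shows "outcome y c k p r"
  using assms(2) halts_silently_reach[OF assms(1)] reach_trans_silent[OF assms(1)]
  by (cases r) (simp_all add: outcome_def)

lemma outcome_step:
  assumes "crun y c = Some (c1, [])" "outcome y c1 k p r" shows "outcome y c k p r"
  by (rule outcome_reach[OF reach_step_silent[where st = "crun y", OF assms(1) reach_refl] assms(2)])

lemma outcome_done: "good_store s \<Longrightarrow> outcome y (k, s, p) k p (Some s)"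
  by (simp add: outcome_def reach_refl)

lemma outcome_bind:
  assumes "outcome y c k p r" "\<And>s. good_store s \<Longrightarrow> outcome y (k, s, p) k' p (f s)"
  shows "outcome y c k' p (Option.bind r f)"
proof (cases r)
  case None
  then show ?thesis using assms(1) by (simp add: outcome_def)
next
  case (Some s)
  then show ?thesis using assms outcome_reach[of y c "(k, s, p)"] by (simp add: outcome_def[of _ c k])
qed

lemma psem_correct:
  assumes "pure c" "good_store s"
  shows "outcome y (c # k, s, p) k p (psem c s)"
  using assms
proof (induction c arbitrary: k s)
  case Skip
  show ?case by (rule outcome_step[where ?c1.0 = "(k, s, p)"]) (use Skip in \<open>auto intro: outcome_done\<close>)
next
  case (Push r a)
  show ?case
    by (rule outcome_step[where ?c1.0 = "(k, s(r := a # s r), p)"])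
      (use Push in \<open>auto intro!: outcome_done good_store_upd simp: good_store_def\<close>)
next
  case (Case r f)
  show ?case
  proof (cases "s r")
    case Nil
    show ?thesis
      by (rule outcome_step[where ?c1.0 = "(f 0 # k, s, p)"]) (use Nil Case in auto)
  next
    case (Cons a as)
    have "outcome y (f a # k, s(r := as), p) k p (psem (f a) (s(r := as)))"
      using Case.IH[of "f a" "s(r := as)" k] Cons Case.prems good_store_pop[of s r a as]
      by (simp add: fun_upd_def)
    then show ?thesis
      using Cons outcome_step[of y "(Case r f # k, s, p)" "(f a # k, s(r := as), p)"] by simp
  qed
next
  case (For r f)
  have "outcome y (For r f # k, s, p) k p (floop r (\<lambda>a. psem (f a)) as s)"
    if "s r = as" "good_store s" for as s
    using that
  proof (induction as arbitrary: s)
    case Nil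
    then have "s(r := []) = s" by (simp add: fun_upd_idem)
    show ?case
      by (rule outcome_step[where ?c1.0 = "(k, s, p)"]) (use Nil \<open>s(r := []) = s\<close> in \<open>auto intro: outcome_done\<close>)
  next
    case (Cons a as)
    let ?s = "s(r := as)" and ?k = "For r f # k"
    have a: "a \<noteq> 0" "good_store ?s" using good_store_pop Cons.prems by blast+
    have f: "outcome y (f a # ?k, ?s, p) ?k p (psem (f a) ?s)"
      using For.IH[of "f a" ?s ?k] For.prems a by (simp add: fun_upd_def)
    have "outcome y (f a # ?k, ?s, p) k p
        (Option.bind (psem (f a) ?s) (floop r (\<lambda>a. psem (f a)) as))"
    proof (cases "psem (f a) ?s")
      case None
      then show ?thesis using f by (simp add: outcome_def)
    next
      case (Some s1)
      have "s1 r = as" using psem_preserves[OF Some] For.prems(1) a by simp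
      moreover have "good_store s1" and r: "reach (crun y) (f a # ?k, ?s, p) [] (?k, s1, p)"
        using f Some by (auto simp: outcome_def)
      ultimately have "outcome y (?k, s1, p) k p (floop r (\<lambda>a. psem (f a)) as s1)"
        by (intro Cons.IH)
      from outcome_reach[OF r this] show ?thesis using Some by simp
    qed
    then show ?case
      using Cons.prems a outcome_step[of y "(For r f # k, s, p)" "(f a # ?k, ?s, p)"] by simp
  qed
  then show ?case using For.prems by simp
next
  case (Seq c1 c2)
  have "outcome y (c1 # c2 # k, s, p) k p (Option.bind (psem c1 s) (psem c2))"
    using Seq by (intro outcome_bind[where k = "c2 # k"]) auto
  then show ?case
    using outcome_step[of y "((c1 ;; c2) # k, s, p)" "(c1 # c2 # k, s, p)"] by simp
next
  case Abort
  then show ?case by (auto simp: outcome_def intro: halts_silently_stuck)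
qed auto

section \<open>Parsing the code of an automaton\<close>

declare bin.simps [simp del]

lemma bin_0 [simp]: "bin 0 = []"
  by (simp add: bin.simps)

lemma bin_pos: "n > 0 \<Longrightarrow> bin n = bin (n div 2) @ [if odd n then 1 else 2]"
  by (subst bin.simps) simp

lemma bin_eq_Nil [simp]: "bin n = [] \<longleftrightarrow> n = 0"
  by (cases "n = 0") (simp_all add: bin_pos)

lemma set_bin: "set (bin n) \<subseteq> {1, 2}"
proof (induction n rule: less_induct)
  case (less n)
  show ?case
  proof (cases "n = 0")
    case False
    then show ?thesis using less[of "n div 2"] by (auto simp: bin_pos[of n])
  qed simp
qed

lemma bin_Cons: "n > 0 \<Longrightarrow> \<exists>w. bin n = 1 # w \<and> set w \<subseteq> {1, 2}"
proof (induction n rule: less_induct)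
  case (less n)
  show ?case
  proof (cases "n = 1")
    case True
    then show ?thesis by (simp add: bin_pos)
  next
    case False
    then have "0 < n div 2" "n div 2 < n" using less.prems by auto
    then obtain w where "bin (n div 2) = 1 # w" "set w \<subseteq> {1, 2}" using less.IH by blast
    then show ?thesis using less.prems by (simp add: bin_pos[of n])
  qed
qed

text \<open>The digit 2 stands for a zero bit, so the numerals are exactly the empty word and the
  words over 1 and 2 that begin with 1. This makes them a regular language, which \<open>dfa\<close>
  can recognize.\<close>

lemma bin_surj: "set w \<subseteq> {1, 2} \<Longrightarrow> \<exists>n. n > 0 \<and> bin n = 1 # w"
proof (induction w rule: rev_induct)
  case Nil
  show ?case by (rule exI[of _ 1]) (simp add: bin_pos)
next
  case (snoc c w)
  then obtain n where n: "n > 0" "bin n = 1 # w" by auto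
  show ?case
  proof (rule exI[of _ "2 * n + (if c = 1 then 1 else 0)"])
    show "0 < 2 * n + (if c = 1 then 1 else 0) \<and> bin (2 * n + (if c = 1 then 1 else 0)) = 1 # w @ [c]"
      using n snoc.prems by (auto simp: bin_pos)
  qed
qed

lemma bin_inj: "bin m = bin n \<longleftrightarrow> m = n"
proof
  show "bin m = bin n \<Longrightarrow> m = n"
  proof (induction m arbitrary: n rule: less_induct)
    case (less m)
    show ?case
    proof (cases "m = 0 \<or> n = 0")
      case True
      then show ?thesis using less.prems by (metis bin_eq_Nil)
    next
      case False
      then have "bin (m div 2) = bin (n div 2)" "odd m = odd n"
        using less.prems by (auto simp: bin_pos split: if_splits)
      moreover from this(1) have "m div 2 = n div 2" using False by (intro less.IH) auto
      ultimately show ?thesis by presburger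
    qed
  qed
qed simp

lemma bin_eq_1: "bin n = [1] \<longleftrightarrow> n = 1"
  using bin_inj[of n 1] by (simp add: bin_pos)

lemma split_unique:
  "x \<notin> set us \<Longrightarrow> x \<notin> set vs \<Longrightarrow> us @ x # ys = vs @ x # zs \<longleftrightarrow> us = vs \<and> ys = zs"
proof (induction us arbitrary: vs)
  case Nil
  then show ?case by (cases vs) auto
next
  case (Cons u us)
  then show ?case by (cases vs) auto
qed

lemma enc_trans_inj:
  assumes "enc_trans t @ xs = enc_trans u @ ys" shows "t = u \<and> xs = ys"
proof -
  obtain a q q' b d where t: "t = (a, q, q', b, d)" by (cases t)
  obtain a2 q2 q2' b2 d2 where u: "u = (a2, q2, q2', b2, d2)" by (cases u)
  have bin3: "3 \<notin> set (bin n)" for n using set_bin[of n] by auto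
  have un3: "3 \<notin> set (unary n)" for n by (simp add: unary_def)
  have "unary m = unary n \<longleftrightarrow> m = n" for m n by (simp add: unary_def)
  moreover have "dir_code d @ 4 # xs = dir_code d2 @ 4 # ys \<longleftrightarrow> d = d2 \<and> xs = ys"
    by (cases d; cases d2) auto
  ultimately show ?thesis using assms unfolding t u
    by (simp add: split_unique[OF bin3 bin3] split_unique[OF un3 un3] bin_inj)
qed

lemma enc_code_Cons: "enc_code (t # ts) = enc_trans t @ enc_code ts"
  by (simp add: enc_code_def)

lemma enc_code_Nil: "enc_code [] = []"
  by (simp add: enc_code_def)

lemma enc_trans_not_Nil: "enc_trans t \<noteq> []"
  by (cases t) simp

text \<open>Unique decodability: it identifies the transition list chosen by \<open>SOME\<close> in
  \<open>delta_of\<close>.\<close>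

lemma enc_code_inj: "enc_code ts = enc_code us \<Longrightarrow> ts = us"
proof (induction ts arbitrary: us)
  case Nil
  then show ?case by (cases us) (auto simp: enc_code_Cons enc_code_Nil enc_trans_not_Nil)
next
  case (Cons t ts)
  show ?case
  proof (cases us)
    case Nil
    then show ?thesis using Cons.prems by (auto simp: enc_code_Cons enc_code_Nil enc_trans_not_Nil)
  next
    case (Cons u us')
    then show ?thesis using Cons.IH Cons.prems enc_trans_inj by (metis enc_code_Cons)
  qed
qed

lemma set_enc_code: "set (enc_code ts) \<subseteq> {1, 2, 3, 4}"
proof (induction ts)
  case (Cons t ts)
  obtain a q q' b d where t: "t = (a, q, q', b, d)" by (cases t)
  have "set (dir_code d) \<subseteq> {1}" by (cases d) auto
  then show ?case using Cons set_bin[of q] set_bin[of q'] unfolding t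
    by (auto simp: enc_code_Cons unary_def)
qed (simp add: enc_code_Nil)

lemma proper_enc_code: "proper (enc_code ts) \<longleftrightarrow> det_code ts"
  unfolding proper_def using enc_code_inj by blast

abbreviation matches :: "nat \<Rightarrow> nat \<Rightarrow> trans list \<Rightarrow> trans list" where
  "matches a q ts \<equiv> filter (\<lambda>t. trans_key t = (a, q)) ts"

lemma delta_of_enc_code:
  assumes "det_code ts"
  shows "delta_of (enc_code ts) (a, q) =
    (case matches a q ts of [] \<Rightarrow> None | (_, _, q', b, d) # _ \<Rightarrow> Some (q', b, d))"
proof -
  have "(SOME us. enc_code ts = enc_code us \<and> det_code us) = ts"
    using assms enc_code_inj by (metis (mono_tags, lifting) someI)
  then have "delta_of (enc_code ts) = map_of (map (\<lambda>(a, q, q', b, d). ((a, q), (q', b, d))) ts)"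
    using assms by (simp add: delta_of_def proper_enc_code)
  moreover have "map_of (map (\<lambda>(a, q, q', b, d). ((a, q), (q', b, d))) ts) (a, q) =
    (case matches a q ts of [] \<Rightarrow> None | (_, _, q', b, d) # _ \<Rightarrow> Some (q', b, d))"
    by (induction ts) (auto simp: trans_key_def)
  ultimately show ?thesis by simp
qed

lemma matches_single:
  assumes "det_code ts" shows "length (matches a q ts) \<le> 1"
  using assms
proof (induction ts)
  case (Cons t ts)
  have "matches a q ts = []" if "trans_key t = (a, q)"
    using Cons.prems that by (auto simp: det_code_def filter_empty_conv image_iff)
  then show ?case using Cons by (auto simp: det_code_def)
qed simp

text \<open>Determinism in the form in which the machine tests it: the key of each transition is
  searched for in the whole code.\<close>

lemma det_codeI:
  assumes "\<And>t. t \<in> set ts \<Longrightarrow> length (filter (\<lambda>u. trans_key u = trans_key t) ts) \<le> 1"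
  shows "det_code ts"
  using assms
proof (induction ts)
  case (Cons t ts)
  have "trans_key u \<noteq> trans_key t" if "u \<in> set ts" for u
  proof
    assume "trans_key u = trans_key t"
    then have "filter (\<lambda>u. trans_key u = trans_key t) ts = []"
      using Cons.prems[of t] by simp
    with that \<open>trans_key u = trans_key t\<close> show False by (auto simp: filter_empty_conv)
  qed
  moreover have "det_code ts"
  proof (rule Cons.IH)
    fix u assume "u \<in> set ts"
    then show "length (filter (\<lambda>v. trans_key v = trans_key u) ts) \<le> 1"
      using Cons.prems[of u] by (auto split: if_splits)
  qed
  moreover from calculation(1) have "trans_key t \<notin> trans_key ` set ts" by (metis imageE)
  ultimately show ?case by (simp add: det_code_def)
qed (simp add: det_code_def)

text \<open>The states of the automaton recognizing \<open>enc_code\<close>: 1 between two transitions,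
  2 in the observed symbol, 3 and 4 at the start of and inside the current state, 5 and 6
  likewise for the new state, 7 in the new symbol, and 8, 9, 10 after 0, 1, 2 symbols of the
  direction; 0 signals an error.\<close>

definition dfa :: "nat \<Rightarrow> nat \<Rightarrow> nat" where
  "dfa st x =
    (if st \<in> {1, 2} then (if x = 1 then 2 else if x = 3 then 3 else 0)
     else if st = 3 then (if x = 1 then 4 else if x = 3 then 5 else 0)
     else if st = 4 then (if x = 1 \<or> x = 2 then 4 else if x = 3 then 5 else 0)
     else if st = 5 then (if x = 1 then 6 else if x = 3 then 7 else 0)
     else if st = 6 then (if x = 1 \<or> x = 2 then 6 else if x = 3 then 7 else 0)
     else if st = 7 then (if x = 1 then 7 else if x = 3 then 8 else 0)
     else if st = 8 then (if x = 1 then 9 else 0)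
     else if st = 9 then (if x = 1 then 10 else if x = 4 then 1 else 0)
     else if st = 10 then (if x = 4 then 1 else 0)
     else 0)"

text \<open>The offset of the work stack that collects a digit; it depends on the state before the
  digit is read.\<close>

definition field :: "nat \<Rightarrow> nat" where
  "field st = (if st \<le> 2 then 2 else if st \<le> 4 then 3 else if st \<le> 6 then 4
     else if st = 7 then 5 else 6)"

definition dfa_run :: "nat \<Rightarrow> nat list \<Rightarrow> nat" where
  "dfa_run = foldl dfa"

lemma dfa_run_simps [simp]:
  "dfa_run st [] = st" "dfa_run st (x # xs) = dfa_run (dfa st x) xs"
  by (simp_all add: dfa_run_def)

lemma dfa_0 [simp]: "dfa 0 x = 0"
  by (simp add: dfa_def)

lemma dfa_run_0 [simp]: "dfa_run 0 xs = 0"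
  by (induction xs) simp_all

text \<open>This and the next four sets are residual languages: what may still follow when the
  parser stands before the closing 4, the new symbol, the new state, the current state, or the
  observed symbol. They are the invariants of \<open>dfa_sound\<close>.\<close>

definition tails_dir :: "nat list set" where
  "tails_dir = {4 # enc_code ts | ts. True}"

definition tails_sym :: "nat list set" where
  "tails_sym = {unary b @ 3 # dir_code d @ z | b d z. z \<in> tails_dir}"

definition tails_new :: "nat list set" where
  "tails_new = {bin q @ 3 # z | q z. z \<in> tails_sym}"

definition tails_cur :: "nat list set" where
  "tails_cur = {bin q @ 3 # z | q z. z \<in> tails_new}"

definition tails_obs :: "nat list set" where
  "tails_obs = {unary a @ 3 # z | a z. z \<in> tails_cur}"

lemma tails_obs_enc_code: "z \<in> tails_obs \<Longrightarrow> z \<in> range enc_code"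
proof -
  assume "z \<in> tails_obs"
  then obtain a q q' b d ts where
    "z = unary a @ 3 # bin q @ 3 # bin q' @ 3 # unary b @ 3 # dir_code d @ 4 # enc_code ts"
    unfolding tails_obs_def tails_cur_def tails_new_def tails_sym_def tails_dir_def by auto
  then have "z = enc_code ((a, q, q', b, d) # ts)" by (simp add: enc_code_Cons)
  then show ?thesis by blast
qed

lemma tails_Cons:
  "z \<in> tails_cur \<Longrightarrow> 3 # z \<in> tails_obs"
  "z \<in> tails_obs \<Longrightarrow> 1 # z \<in> tails_obs"
  "z \<in> tails_new \<Longrightarrow> 3 # z \<in> tails_cur"
  "z \<in> tails_sym \<Longrightarrow> 3 # z \<in> tails_new"
  "z \<in> tails_sym \<Longrightarrow> 1 # z \<in> tails_sym"
proof -
  show "z \<in> tails_cur \<Longrightarrow> 3 # z \<in> tails_obs"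
    unfolding tails_obs_def by (rule CollectI, rule exI[of _ 0]) (auto simp: unary_def)
  show "1 # z \<in> tails_obs" if z: "z \<in> tails_obs"
  proof -
    obtain a z' where "z = unary a @ 3 # z'" "z' \<in> tails_cur" using z unfolding tails_obs_def by auto
    then have "1 # z = unary (Suc a) @ 3 # z'" "z' \<in> tails_cur" by (simp_all add: unary_def)
    then show ?thesis unfolding tails_obs_def by blast
  qed
  show "z \<in> tails_new \<Longrightarrow> 3 # z \<in> tails_cur"
    unfolding tails_cur_def by (rule CollectI, rule exI[of _ 0]) auto
  show "z \<in> tails_sym \<Longrightarrow> 3 # z \<in> tails_new"
    unfolding tails_new_def by (rule CollectI, rule exI[of _ 0]) auto
  show "1 # z \<in> tails_sym" if z: "z \<in> tails_sym"
  proof -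
    obtain b d z' where "z = unary b @ 3 # dir_code d @ z'" "z' \<in> tails_dir"
      using z unfolding tails_sym_def by auto
    then have "1 # z = unary (Suc b) @ 3 # dir_code d @ z'" "z' \<in> tails_dir"
      by (simp_all add: unary_def)
    then show ?thesis unfolding tails_sym_def by blast
  qed
qed

lemma tails_word:
  assumes "set w \<subseteq> {1, 2}"
  shows "z \<in> tails_new \<Longrightarrow> 1 # w @ 3 # z \<in> tails_cur"
    "z \<in> tails_sym \<Longrightarrow> 1 # w @ 3 # z \<in> tails_new"
proof -
  obtain n where "bin n = 1 # w" using bin_surj[OF assms] by blast
  then have "1 # w @ 3 # z = bin n @ 3 # z" by simp
  then show "z \<in> tails_new \<Longrightarrow> 1 # w @ 3 # z \<in> tails_cur"
    "z \<in> tails_sym \<Longrightarrow> 1 # w @ 3 # z \<in> tails_new"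
    unfolding tails_cur_def tails_new_def by blast+
qed

text \<open>In states 4 and 6 the leading 1 of a numeral is already consumed, so any digits may
  follow, by \<open>bin_surj\<close>; in state 9 one digit of the direction is consumed, hence the
  \<open>1 # xs\<close>. The converse, that codes are accepted, comes out of
  \<open>parse_enc_code\<close>.\<close>

lemma dfa_sound:
  assumes "dfa_run st xs = 1"
  shows "(st = 1 \<longrightarrow> xs \<in> range enc_code) \<and> (st = 2 \<longrightarrow> xs \<in> tails_obs) \<and>
    (st = 3 \<longrightarrow> xs \<in> tails_cur) \<and>
    (st = 4 \<longrightarrow> (\<exists>w z. xs = w @ 3 # z \<and> set w \<subseteq> {1, 2} \<and> z \<in> tails_new)) \<and>
    (st = 5 \<longrightarrow> xs \<in> tails_new) \<and>
    (st = 6 \<longrightarrow> (\<exists>w z. xs = w @ 3 # z \<and> set w \<subseteq> {1, 2} \<and> z \<in> tails_sym)) \<and>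
    (st = 7 \<longrightarrow> xs \<in> tails_sym) \<and>
    (st = 8 \<longrightarrow> (\<exists>d z. xs = dir_code d @ z \<and> z \<in> tails_dir)) \<and>
    (st = 9 \<longrightarrow> (\<exists>d z. 1 # xs = dir_code d @ z \<and> z \<in> tails_dir)) \<and>
    (st = 10 \<longrightarrow> xs \<in> tails_dir)"
  using assms
proof (induction xs arbitrary: st)
  case Nil
  then show ?case using enc_code_Nil by (auto simp: image_iff) metis
next
  case (Cons x xs)
  have run: "dfa_run (dfa st x) xs = 1" using Cons.prems by simp
  have I: "dfa st x = 1 \<Longrightarrow> xs \<in> range enc_code" "dfa st x = 2 \<Longrightarrow> xs \<in> tails_obs"
    "dfa st x = 3 \<Longrightarrow> xs \<in> tails_cur" "dfa st x = 5 \<Longrightarrow> xs \<in> tails_new"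
    "dfa st x = 7 \<Longrightarrow> xs \<in> tails_sym" "dfa st x = 10 \<Longrightarrow> xs \<in> tails_dir"
    and I4: "dfa st x = 4 \<Longrightarrow> \<exists>w z. xs = w @ 3 # z \<and> set w \<subseteq> {1, 2} \<and> z \<in> tails_new"
    and I6: "dfa st x = 6 \<Longrightarrow> \<exists>w z. xs = w @ 3 # z \<and> set w \<subseteq> {1, 2} \<and> z \<in> tails_sym"
    and I8: "dfa st x = 8 \<Longrightarrow> \<exists>d z. xs = dir_code d @ z \<and> z \<in> tails_dir"
    and I9: "dfa st x = 9 \<Longrightarrow> \<exists>d z. 1 # xs = dir_code d @ z \<and> z \<in> tails_dir"
    using Cons.IH[OF run] by blast+
  \<comment> \<open>The error state 0 is absorbing, so a run that ends in state 1 never enters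
    it.\<close>
  have ne: "dfa st x \<noteq> 0" using run by (metis dfa_run_0 zero_neq_one)
  have 1: "x # xs \<in> tails_obs" if "st = 1 \<or> st = 2"
  proof -
    have "x = 1 \<and> dfa st x = 2 \<or> x = 3 \<and> dfa st x = 3"
      using that ne by (auto simp: dfa_def split: if_splits)
    then show ?thesis using I tails_Cons[of xs] by metis
  qed
  have word: "\<exists>w z'. x # xs = w @ 3 # z' \<and> set w \<subseteq> {1, 2} \<and> z' \<in> Z"
    if "x = 1 \<or> x = 2" "xs = w @ 3 # z" "set w \<subseteq> {1, 2}" "z \<in> Z" for w z Z
    by (rule exI[of _ "x # w"]) (use that in auto)
  have word': "\<exists>w z'. x # xs = w @ 3 # z' \<and> set w \<subseteq> {1, 2} \<and> z' \<in> Z"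
    if "x = 3" "xs \<in> Z" for Z
    by (rule exI[of _ "[]"]) (use that in auto)
  have 3: "x # xs \<in> tails_cur" if "st = 3"
  proof -
    have "x = 1 \<and> dfa st x = 4 \<or> x = 3 \<and> dfa st x = 5"
      using that ne by (auto simp: dfa_def split: if_splits)
    then show ?thesis
    proof
      assume *: "x = 1 \<and> dfa st x = 4"
      then show ?thesis using I4 tails_word(1) by metis
    qed (use I tails_Cons[of xs] in metis)
  qed
  have 4: "\<exists>w z. x # xs = w @ 3 # z \<and> set w \<subseteq> {1, 2} \<and> z \<in> tails_new" if "st = 4"
  proof -
    have "(x = 1 \<or> x = 2) \<and> dfa st x = 4 \<or> x = 3 \<and> dfa st x = 5"
      using that ne by (auto simp: dfa_def split: if_splits)
    then show ?thesis
    proof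
      assume *: "(x = 1 \<or> x = 2) \<and> dfa st x = 4"
      then obtain w z where "xs = w @ 3 # z" "set w \<subseteq> {1, 2}" "z \<in> tails_new"
        using I4 by blast
      then show ?thesis using * by (intro word) auto
    next
      assume "x = 3 \<and> dfa st x = 5"
      then show ?thesis using I by (intro word') metis+
    qed
  qed
  have 5: "x # xs \<in> tails_new" if "st = 5"
  proof -
    have "x = 1 \<and> dfa st x = 6 \<or> x = 3 \<and> dfa st x = 7"
      using that ne by (auto simp: dfa_def split: if_splits)
    then show ?thesis
    proof
      assume *: "x = 1 \<and> dfa st x = 6"
      then show ?thesis using I6 tails_word(2) by metis
    qed (use I tails_Cons[of xs] in metis)
  qed
  have 6: "\<exists>w z. x # xs = w @ 3 # z \<and> set w \<subseteq> {1, 2} \<and> z \<in> tails_sym" if "st = 6"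
  proof -
    have "(x = 1 \<or> x = 2) \<and> dfa st x = 6 \<or> x = 3 \<and> dfa st x = 7"
      using that ne by (auto simp: dfa_def split: if_splits)
    then show ?thesis
    proof
      assume *: "(x = 1 \<or> x = 2) \<and> dfa st x = 6"
      then obtain w z where "xs = w @ 3 # z" "set w \<subseteq> {1, 2}" "z \<in> tails_sym"
        using I6 by blast
      then show ?thesis using * by (intro word) auto
    next
      assume "x = 3 \<and> dfa st x = 7"
      then show ?thesis using I by (intro word') metis+
    qed
  qed
  have 7: "x # xs \<in> tails_sym" if "st = 7"
  proof -
    have "x = 1 \<and> dfa st x = 7 \<or> x = 3 \<and> dfa st x = 8"
      using that ne by (auto simp: dfa_def split: if_splits)
    then show ?thesis
    proof
      assume "x = 3 \<and> dfa st x = 8"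
      then obtain d z where "xs = dir_code d @ z" "z \<in> tails_dir" using I8 by blast
      then have "x # xs = unary 0 @ 3 # dir_code d @ z" "z \<in> tails_dir"
        using \<open>x = 3 \<and> _\<close> by (simp_all add: unary_def)
      then show ?thesis unfolding tails_sym_def by blast
    qed (use I tails_Cons[of xs] in metis)
  qed
  have 8: "\<exists>d z. x # xs = dir_code d @ z \<and> z \<in> tails_dir" if "st = 8"
  proof -
    have "x = 1 \<and> dfa st x = 9" using that ne by (auto simp: dfa_def split: if_splits)
    then show ?thesis using I9 by metis
  qed
  have t4: "4 # xs \<in> tails_dir" if "xs \<in> range enc_code"
    using that unfolding tails_dir_def by auto
  have 9: "\<exists>d z. 1 # x # xs = dir_code d @ z \<and> z \<in> tails_dir" if "st = 9"
  proof -
    have "x = 1 \<and> dfa st x = 10 \<or> x = 4 \<and> dfa st x = 1"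
      using that ne by (auto simp: dfa_def split: if_splits)
    then show ?thesis
    proof
      assume "x = 1 \<and> dfa st x = 10"
      then show ?thesis using I(6) by (intro exI[of _ Right] exI[of _ xs]) auto
    next
      assume "x = 4 \<and> dfa st x = 1"
      then show ?thesis using I(1) t4 by (intro exI[of _ Left] exI[of _ "4 # xs"]) auto
    qed
  qed
  have 10: "x # xs \<in> tails_dir" if "st = 10"
  proof -
    have "x = 4 \<and> dfa st x = 1" using that ne by (auto simp: dfa_def split: if_splits)
    then show ?thesis using I(1) t4 by metis
  qed
  show ?case using 1 tails_obs_enc_code 3 4 5 6 7 8 9 10 by (intro conjI impI) simp_all
qed

declare One_nat_def [simp del]

text \<open>The equations generated for \<^const>\<open>psem\<close> are eta-expanded on the right, which makes
  the simplifier evaluate loop bodies under the binder.\<close>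

lemma psem_For: "psem (For r f) s = floop r (\<lambda>a. psem (f a)) (s r) s"
  by (rule psem.simps)

lemma psem_Seq: "psem (a ;; b) s = Option.bind (psem a s) (psem b)"
  by (rule psem.simps)

declare psem.simps(4,5) [simp del] psem_For [simp] psem_Seq [simp]

section \<open>Programs\<close>

text \<open>Layout of the stacks: 17 input tape (its code), 18 state (in binary, least significant
  digit on top), 12 output tape (last symbol on top), 13 head position (unary);
  2 and 3 observed symbol and state to be looked up, 4 flag for a transition found and
  5, 6, 7 its new state, new symbol and direction; 8--11 and 14--16 scratch; 20--27 and
  30--37 work space of the two nested loops over all transitions.\<close>

definition clear :: "nat \<Rightarrow> com" where
  "clear r = For r (\<lambda>_. Skip)"

text \<open>Reading a stack destroys it, so the contents travel through the scratch stack
  \<open>u\<close>; the two reversals cancel, both for the copy and for the restored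
  original.\<close>

definition copy :: "nat \<Rightarrow> nat \<Rightarrow> nat \<Rightarrow> com" where
  "copy r t u = For r (Push u) ;; For u (\<lambda>a. Push r a ;; Push t a)"

lemma psem_clear [simp]: "psem (clear r) s = Some (s(r := []))"
proof -
  have "floop r (\<lambda>a. psem Skip) as s = Some (s(r := []))" for as
    by (induction as arbitrary: s) simp_all
  then show ?thesis by (simp add: clear_def)
qed

lemma floop_push:
  "r \<noteq> u \<Longrightarrow> floop r (\<lambda>a. psem (Push u a)) as s = Some (s(r := [], u := rev as @ s u))"
  by (induction as arbitrary: s) (auto simp: fun_upd_twist)

lemma floop_push2:
  "r \<noteq> u \<Longrightarrow> t \<noteq> u \<Longrightarrow> r \<noteq> t \<Longrightarrow>
   floop u (\<lambda>a. psem (Push r a ;; Push t a)) as s =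
     Some (s(u := [], r := rev as @ s r, t := rev as @ s t))"
  by (induction as arbitrary: s) (auto intro!: ext)

lemma psem_copy [simp]:
  "r \<noteq> u \<Longrightarrow> t \<noteq> u \<Longrightarrow> r \<noteq> t \<Longrightarrow> s u = [] \<Longrightarrow>
   psem (copy r t u) s = Some (s(t := s r @ s t))"
  by (auto simp: copy_def floop_push floop_push2 intro!: ext)

text \<open>The number of marks that the comparison program leaves behind; what counts is only
  whether it is 0.\<close>

fun mism :: "nat list \<Rightarrow> nat list \<Rightarrow> nat" where
  "mism [] ys = length ys"
| "mism (a # as) [] = Suc (mism as [])"
| "mism (a # as) (b # bs) = (if b = a then mism as bs else Suc (mism as bs))"

lemma mism_eq_0: "mism xs ys = 0 \<longleftrightarrow> xs = ys"
  by (induction xs ys rule: mism.induct) auto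

text \<open>Compares stacks \<open>r1\<close> and \<open>r2\<close>; the stack 10 remains empty iff they are equal.\<close>

definition cmp_body :: "nat \<Rightarrow> com" where
  "cmp_body a = Case 9 (\<lambda>c. if c = a then Skip else Push 10 1)"

definition cmp :: "nat \<Rightarrow> nat \<Rightarrow> com" where
  "cmp r1 r2 = copy r1 8 11 ;; copy r2 9 11 ;; For 8 cmp_body ;; For 9 (\<lambda>_. Push 10 1)"

lemma replicate_app_Cons: "replicate n x @ x # xs = x # replicate n x @ xs"
  by (induction n) auto

lemma floop_push1: "r \<noteq> u \<Longrightarrow> floop r (\<lambda>_. psem (Push u 1)) as s =
    Some (s(r := [], u := replicate (length as) 1 @ s u))"
  by (induction as arbitrary: s) (auto simp: fun_upd_twist replicate_app_Cons)

text \<open>Both loops are treated together because the second one adds a mark for each symbol of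
  stack 9 that the first one has left over.\<close>

lemma floop_cmp:
  assumes "0 \<notin> set as"
  shows "Option.bind (floop 8 (\<lambda>a. psem (cmp_body a)) as s) (psem (For 9 (\<lambda>_. Push 10 1)))
    = Some (s(8 := [], 9 := [], 10 := replicate (mism as (s 9)) 1 @ s 10))"
  using assms
proof (induction as arbitrary: s)
  case Nil
  have "Option.bind (floop 8 (\<lambda>a. psem (cmp_body a)) [] s) (psem (For 9 (\<lambda>_. Push 10 1)))
    = Some (s(8 := [], 9 := [], 10 := replicate (mism [] (s 9)) 1 @ s 10))"
    by (simp add: floop_push1)
  then show ?case .
next
  case (Cons a as)
  have "psem (cmp_body a) (s(8 := as)) = Some (if s 9 \<noteq> [] \<and> hd (s 9) = a
      then s(8 := as, 9 := tl (s 9)) else s(8 := as, 9 := tl (s 9), 10 := 1 # s 10))"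
    using Cons.prems by (cases "s 9") (auto simp: cmp_body_def fun_upd_idem fun_upd_twist)
  moreover have "Option.bind (floop 8 (\<lambda>a. psem (cmp_body a)) as s) (psem (For 9 (\<lambda>_. Push 10 1)))
    = Some (s(8 := [], 9 := [], 10 := replicate (mism as (s 9)) 1 @ s 10))" for s
    using Cons.prems by (intro Cons.IH) simp
  ultimately have "Option.bind (floop 8 (\<lambda>a. psem (cmp_body a)) (a # as) s)
      (psem (For 9 (\<lambda>_. Push 10 1)))
    = Some (s(8 := [], 9 := [], 10 := replicate (mism (a # as) (s 9)) 1 @ s 10))"
    by (cases "s 9") (auto simp: replicate_app_Cons simp del: psem_For intro!: ext)
  then show ?case .
qed

lemma psem_cmp [simp]:
  assumes "r1 \<notin> {8, 9, 10, 11}" "r2 \<notin> {8, 9, 10, 11}" "r1 \<noteq> r2" "0 \<notin> set (s r1)"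
    and "s 8 = []" "s 9 = []" "s 11 = []"
  shows "psem (cmp r1 r2) s = Some (s(10 := replicate (mism (s r1) (s r2)) 1 @ s 10))"
proof -
  have "psem (cmp r1 r2) s = Some (s(8 := [], 9 := [], 10 := replicate (mism (s r1) (s r2)) 1 @ s 10))"
    using assms floop_cmp[of "s r1" "s(8 := s r1, 9 := s r2)"]
    by (simp add: cmp_def del: psem_For) (simp add: fun_upd_twist)
  then show ?thesis using assms by (auto simp: fun_upd_idem_iff intro!: ext)
qed

text \<open>Stack 17 contains a code.  \<open>for_trans b E\<close> executes \<open>E\<close> for each transition in it, with
  the components of the transition on the stacks \<open>b + 2, ..., b + 6\<close> (the states reversed,
  i.e. with the least significant digit on top).\<close>

definition tstep :: "nat \<Rightarrow> com \<Rightarrow> nat \<Rightarrow> nat \<Rightarrow> com" where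
  "tstep b E x st =
    (if dfa st x = 0 then Abort
     else Push (b + 1) (dfa st x) ;;
       (if x = 4 then
          E ;; clear (b + 2) ;; clear (b + 3) ;; clear (b + 4) ;; clear (b + 5) ;; clear (b + 6)
        else if x = 3 then Skip else Push (b + field st) x))"

definition for_trans :: "nat \<Rightarrow> com \<Rightarrow> com" where
  "for_trans b E = copy 17 b (b + 7) ;; Push (b + 1) 1 ;;
     For b (\<lambda>x. Case (b + 1) (tstep b E x)) ;;
     Case (b + 1) (\<lambda>st. if st = 1 then Skip else Abort)"

text \<open>The store in the middle of a loop over all transitions: the unread rest of the code, the
  parser state and the partly collected fields \<open>F\<close> are laid over a store
  \<open>s\<close>, on which the loop body is meant to act.\<close>

definition scan :: "nat \<Rightarrow> nat list \<Rightarrow> nat \<Rightarrow> (nat \<Rightarrow> nat list) \<Rightarrow> store \<Rightarrow> store" where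
  "scan b rest st F s = (\<lambda>r. if r = b then rest else if r = b + 1 then [st]
     else if b + 2 \<le> r \<and> r \<le> b + 6 then F (r - b) else s r)"

abbreviation no_fields :: "nat \<Rightarrow> nat list" where "no_fields \<equiv> \<lambda>_. []"

fun fields :: "trans \<Rightarrow> nat \<Rightarrow> nat list" where
  "fields (a, q, q', c, d) = no_fields(2 := unary a, 3 := rev (bin q), 4 := rev (bin q'),
     5 := unary c, 6 := dir_code d)"

definition clean :: "nat \<Rightarrow> store \<Rightarrow> bool" where
  "clean b s \<longleftrightarrow> (\<forall>r. b \<le> r \<and> r \<le> b + 7 \<longrightarrow> s r = [])"

definition parse :: "nat \<Rightarrow> com \<Rightarrow> nat list \<Rightarrow> nat \<Rightarrow> (nat \<Rightarrow> nat list) \<Rightarrow> store \<Rightarrow> store option" where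
  "parse b E xs st F s = floop b (\<lambda>x. psem (Case (b + 1) (tstep b E x))) xs (scan b [] st F s)"

text \<open>Each equation of \<open>floop\<close> overwrites stack \<open>r\<close> first, so its
  former content is never seen; intermediate stores can thus be written with any unread
  rest.\<close>

lemma floop_irrelevant: "floop r g as (s(r := bs)) = floop r g as s"
  by (cases as) simp_all

lemma scan_rest: "(scan b rest st F s)(b := xs) = scan b xs st F s"
  by (auto simp: scan_def)

lemma parse_scan:
  "floop b (\<lambda>x. psem (Case (b + 1) (tstep b E x))) xs (scan b rest st F s) = parse b E xs st F s"
  unfolding parse_def by (subst (1 2) floop_irrelevant[symmetric, where bs = "[]"]) (simp add: scan_rest)

lemma parse_Nil: "parse b E [] st F s = Some (scan b [] st F s)"
  by (simp add: parse_def scan_rest)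

lemma field_range: "2 \<le> field st" "field st \<le> 6"
  by (simp_all add: field_def)

lemma parse_Cons: "parse b E (x # xs) st F s =
    Option.bind (psem (tstep b E x st) ((scan b xs st F s)(b + 1 := [])))
      (floop b (\<lambda>x. psem (Case (b + 1) (tstep b E x))) xs)"
  unfolding parse_def by (simp add: scan_rest) (simp add: scan_def)

lemma parse_error: "dfa st x = 0 \<Longrightarrow> parse b E (x # xs) st F s = None"
  by (simp add: parse_Cons tstep_def)

lemma scan_state: "(scan b xs st F s)(b + 1 := [st']) = scan b xs st' F s"
  by (intro ext) (auto simp: scan_def)

lemma scan_at: "scan b xs st F s b = xs" "scan b xs st F s (b + 1) = [st]"
  by (simp_all add: scan_def)

lemma parse_sep: "dfa st 3 \<noteq> 0 \<Longrightarrow> parse b E (3 # xs) st F s = parse b E xs (dfa st 3) F s"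
  by (simp add: parse_Cons tstep_def scan_state parse_scan)

lemma parse_sym:
  assumes "dfa st x \<noteq> 0" "x \<noteq> 3" "x \<noteq> 4"
  shows "parse b E (x # xs) st F s =
    parse b E xs (dfa st x) (F(field st := x # F (field st))) s"
proof -
  have "(scan b xs st' F s)(b + field st := x # scan b xs st' F s (b + field st)) =
      scan b xs st' (F(field st := x # F (field st))) s" for st'
    using field_range[of st] by (intro ext) (auto simp: scan_def)
  with assms show ?thesis
    by (simp add: parse_Cons tstep_def scan_state parse_scan)
qed

definition clear_fields :: "nat \<Rightarrow> store \<Rightarrow> store" where
  "clear_fields b s = s(b + 2 := [], b + 3 := [], b + 4 := [], b + 5 := [], b + 6 := [])"

lemma clear_fields_scan: "clear_fields b (scan b xs st F s) = scan b xs st no_fields s"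
proof
  fix r
  show "clear_fields b (scan b xs st F s) r = scan b xs st no_fields s r"
  proof (cases "b + 2 \<le> r \<and> r \<le> b + 6")
    case True
    then have "r \<in> {b + 2, b + 3, b + 4, b + 5, b + 6}" by auto
    then show ?thesis by (auto simp: clear_fields_def scan_def)
  qed (auto simp: clear_fields_def scan_def)
qed

lemma parse_end:
  assumes "dfa st 4 \<noteq> 0"
  shows "parse b E (4 # xs) st F s = Option.bind (psem E (scan b xs (dfa st 4) F s))
    (\<lambda>s'. floop b (\<lambda>x. psem (Case (b + 1) (tstep b E x))) xs (clear_fields b s'))"
  using assms
  by (simp add: parse_Cons tstep_def scan_state clear_fields_def)

lemma parse_replicate:
  assumes "dfa st 1 = st" "st \<noteq> 0"
  shows "parse b E (replicate n 1 @ xs) st F s =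
    parse b E xs st (F(field st := replicate n 1 @ F (field st))) s"
proof (induction n arbitrary: F)
  case (Suc n)
  have IH: "parse b E (replicate n 1 @ xs) st F s =
      parse b E xs st (F(field st := replicate n 1 @ F (field st))) s" for F
    by (rule Suc.IH)
  have "parse b E (replicate (Suc n) 1 @ xs) st F s =
      parse b E xs st (F(field st := replicate (Suc n) 1 @ F (field st))) s"
    using assms parse_sym[of st 1 b E "replicate n 1 @ xs" F s]
    by (simp add: IH replicate_app_Cons)
  then show ?case .
qed simp

lemma parse_word:
  assumes "dfa st 1 = st" "dfa st 2 = st" "st \<noteq> 0" "set w \<subseteq> {1, 2}"
  shows "parse b E (w @ xs) st F s = parse b E xs st (F(field st := rev w @ F (field st))) s"
  using assms(4)
proof (induction w arbitrary: F)
  case (Cons x w)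
  then have "parse b E (x # w @ xs) st F s = parse b E (w @ xs) st (F(field st := x # F (field st))) s"
    using assms(1-3) parse_sym[of st 1] parse_sym[of st 2] by auto
  moreover have "parse b E (w @ xs) st F s = parse b E xs st (F(field st := rev w @ F (field st))) s" for F
    using Cons.prems by (intro Cons.IH) simp
  ultimately have "parse b E ((x # w) @ xs) st F s =
      parse b E xs st (F(field st := rev (x # w) @ F (field st))) s" by simp
  then show ?case .
qed simp

lemma parse_unary:
  "parse b E (unary n @ 3 # xs) 1 F s = parse b E xs 3 (F(2 := unary n @ F 2)) s"
proof (cases n)
  case 0
  then show ?thesis by (simp add: unary_def parse_sep dfa_def)
next
  case (Suc m)
  have "parse b E (1 # replicate m 1 @ 3 # xs) 1 F s =
      parse b E (replicate m 1 @ 3 # xs) 2 (F(2 := 1 # F 2)) s"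
    using parse_sym[of 1 1 b E "replicate m 1 @ 3 # xs" F s] by (simp add: dfa_def field_def)
  also have "\<dots> = parse b E xs 3 (F(2 := replicate m 1 @ 1 # F 2)) s"
    using parse_replicate[of 2 b E m "3 # xs" "F(2 := 1 # F 2)" s]
    by (simp add: dfa_def field_def parse_sep)
  finally show ?thesis by (simp add: unary_def Suc replicate_app_Cons)
qed

lemma parse_bin:
  assumes "(st, st') = (3, 5) \<or> (st, st') = (5, 7)"
  shows "parse b E (bin n @ 3 # xs) st F s =
    parse b E xs st' (F(field st := rev (bin n) @ F (field st))) s"
proof (cases "n = 0")
  case True
  then show ?thesis using assms by (auto simp: parse_sep dfa_def)
next
  case False
  then obtain w where w: "bin n = 1 # w" "set w \<subseteq> {1, 2}" using bin_Cons by blast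
  have "dfa st 1 = Suc st" "field (Suc st) = field st" "dfa (Suc st) 3 = st'" "st' \<noteq> 0"
    "dfa (Suc st) 1 = Suc st" "dfa (Suc st) 2 = Suc st"
    using assms by (auto simp: dfa_def field_def)
  with w show ?thesis
    using parse_sym[of st 1 b E "w @ 3 # xs" F s]
      parse_word[of "Suc st" w b E "3 # xs" "F(field st := 1 # F (field st))" s]
    by (simp add: parse_sep)
qed

lemma parse_trans:
  "parse b E (enc_trans t @ xs) 1 no_fields s = Option.bind (psem E (scan b xs 1 (fields t) s))
    (\<lambda>s'. floop b (\<lambda>x. psem (Case (b + 1) (tstep b E x))) xs (clear_fields b s'))"
proof -
  obtain a q q' c d where t: "t = (a, q, q', c, d)" by (cases t)
  have F: "parse b E (unary a @ 3 # bin q @ 3 # bin q' @ 3 # unary c @ 3 # ys) 1 no_fields s =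
      parse b E ys 8 (no_fields(2 := unary a, 3 := rev (bin q), 4 := rev (bin q'), 5 := unary c)) s" for ys
    using parse_replicate[of 7 b E c "3 # ys"
        "no_fields(2 := unary a, 3 := rev (bin q), 4 := rev (bin q'))" s]
    by (simp add: parse_unary parse_bin[of 3 5, simplified] parse_bin[of 5 7, simplified]
        field_def) (simp add: unary_def dfa_def parse_sep)
  have "dfa 8 1 = 9" "dfa 9 1 = 10" "dfa 9 4 = 1" "dfa 10 4 = 1" by (simp_all add: dfa_def)
  then show ?thesis
    using parse_sym[of 8 1 b E] parse_sym[of 9 1 b E]
    by (cases d) (simp_all add: t F parse_end field_def)
qed

primrec ofold :: "(trans \<Rightarrow> store \<Rightarrow> store option) \<Rightarrow> trans list \<Rightarrow> store \<Rightarrow> store option" where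
  "ofold f [] s = Some s"
| "ofold f (t # ts) s = Option.bind (f t s) (ofold f ts)"

text \<open>If \<open>E\<close> changes only the underlying store, and does so as \<open>f\<close>
  prescribes, then the parsing loop is a fold of \<open>f\<close> over the transition list. The
  invariant \<open>I\<close> holds what \<open>E\<close> needs to find on its scratch
  stacks.\<close>

lemma parse_enc_code:
  assumes E: "\<And>t rest s. I s \<Longrightarrow> psem E (scan b rest 1 (fields t) s) =
      map_option (scan b rest 1 (fields t)) (f t s)"
    and I: "\<And>t s s'. I s \<Longrightarrow> f t s = Some s' \<Longrightarrow> I s'"
    and "I s"
  shows "parse b E (enc_code ts) 1 no_fields s = map_option (scan b [] 1 no_fields) (ofold f ts s)"
  using \<open>I s\<close>
proof (induction ts arbitrary: s)
  case Nil
  then show ?case by (simp add: enc_code_Nil parse_Nil)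
next
  case (Cons t ts)
  show ?case
  proof (cases "f t s")
    case None
    then show ?thesis by (simp add: enc_code_Cons parse_trans E[OF Cons.prems])
  next
    case (Some s')
    then show ?thesis using Cons.IH[OF I[OF Cons.prems Some]]
      by (simp add: enc_code_Cons parse_trans E[OF Cons.prems] clear_fields_scan parse_scan)
  qed
qed

lemma scan_start: "clean b s \<Longrightarrow> s(b := xs, b + 1 := [st]) = scan b xs st no_fields s"
  by (auto simp: scan_def clean_def)

lemma scan_clean: "clean b s \<Longrightarrow> (scan b [] st no_fields s)(b + 1 := []) = s"
  by (auto simp: scan_def clean_def)

lemma psem_for_trans_parse:
  assumes "clean b s" "17 < b"
  shows "psem (for_trans b E) s = Option.bind (parse b E (s 17) 1 no_fields s)
    (psem (Case (b + 1) (\<lambda>st. if st = 1 then Skip else Abort)))"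
proof -
  have "s (b + 7) = []" "s b = []" "s (b + 1) = []" using assms(1) by (simp_all add: clean_def)
  then show ?thesis using assms scan_start[OF assms(1), of "s 17" 1]
    by (simp add: for_trans_def scan_at parse_scan)
qed

lemma psem_for_trans:
  assumes E: "\<And>t rest s. I s \<Longrightarrow> psem E (scan b rest 1 (fields t) s) =
      map_option (scan b rest 1 (fields t)) (f t s)"
    and I: "\<And>t s s'. I s \<Longrightarrow> f t s = Some s' \<Longrightarrow> I s'"
    and clean: "\<And>s. I s \<Longrightarrow> clean b s"
    and "I s" "s 17 = enc_code ts" "17 < b"
  shows "psem (for_trans b E) s = ofold f ts s"
proof -
  have "I s' " if "ofold f ts s = Some s'" for s'
    using that \<open>I s\<close> by (induction ts arbitrary: s) (auto split: bind_splits intro: I)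
  with assms show ?thesis
    by (cases "ofold f ts s")
      (simp_all add: psem_for_trans_parse parse_enc_code[where I = I and f = f] scan_clean scan_at)
qed

text \<open>Unlike the preceding lemmas this one concerns arbitrary words, so that bad tapes can be
  rejected. The fields left by an incomplete transition stay unspecified as
  \<open>F'\<close>.\<close>

lemma parse_Skip:
  "st \<noteq> 0 \<Longrightarrow> if dfa_run st xs = 0 then parse b Skip xs st F s = None
   else \<exists>F'. parse b Skip xs st F s = Some (scan b [] (dfa_run st xs) F' s)"
proof (induction xs arbitrary: st F)
  case Nil
  then show ?case by (auto simp: parse_Nil)
next
  case (Cons x xs)
  consider "dfa st x = 0" | "dfa st x \<noteq> 0" "x = 3" | "dfa st x \<noteq> 0" "x = 4"
    | "dfa st x \<noteq> 0" "x \<noteq> 3" "x \<noteq> 4" by blast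
  then show ?case
  proof cases
    case 1
    then show ?thesis by (simp add: parse_error)
  next
    case 2
    then show ?thesis using Cons.IH[of "dfa st 3" F] by (simp add: parse_sep)
  next
    case 3
    then show ?thesis using Cons.IH[of "dfa st 4" no_fields]
      by (simp add: parse_end clear_fields_scan parse_scan)
  next
    case 4
    then show ?thesis using Cons.IH[of "dfa st x" "F(field st := x # F (field st))"]
      by (simp add: parse_sym)
  qed
qed

lemma psem_for_trans_Skip:
  assumes "clean b s" "17 < b"
  shows "psem (for_trans b Skip) s = (if s 17 \<in> range enc_code then Some s else None)"
proof (cases "s 17 \<in> range enc_code")
  case True
  then obtain ts where ts: "s 17 = enc_code ts" by blast
  have "ofold (\<lambda>_. Some) ts s = Some s" by (induction ts) simp_all
  then show ?thesis
    using psem_for_trans[of "\<lambda>s. clean b s" Skip b "\<lambda>_. Some" s ts] ts assms by simp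
next
  case False
  then have "dfa_run 1 (s 17) \<noteq> 1" using dfa_sound by blast
  then show ?thesis using parse_Skip[of 1 "s 17" b no_fields s] False
    by (auto simp: psem_for_trans_parse[OF assms] scan_at split: if_splits)
qed

section \<open>Searching for a transition and testing determinism\<close>

text \<open>Aborting at a second match lets the same program serve both as the search for the
  applicable transition and as the determinism test.\<close>

definition lookup :: "nat \<Rightarrow> com" where
  "lookup b = cmp 2 (b + 2) ;; cmp 3 (b + 3) ;;
     Case 10 (\<lambda>x. if x = 0 then
         Case 4 (\<lambda>m. if m = 0 then
             Push 4 1 ;; copy (b + 4) 5 11 ;; copy (b + 5) 6 11 ;; copy (b + 6) 7 11
           else Abort)
       else clear 10)"

definition found :: "trans \<Rightarrow> store \<Rightarrow> store" where
  "found t s = (case t of (_, _, q', c, d) \<Rightarrow>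
     s(4 := [1], 5 := rev (bin q') @ s 5, 6 := unary c @ s 6, 7 := dir_code d @ s 7))"

definition lookup_fun :: "nat \<Rightarrow> nat \<Rightarrow> trans \<Rightarrow> store \<Rightarrow> store option" where
  "lookup_fun a q t s = (if trans_key t \<noteq> (a, q) then Some s
     else if s 4 \<noteq> [] then None else Some (found t s))"

definition lookup_inv :: "nat \<Rightarrow> nat \<Rightarrow> store \<Rightarrow> bool" where
  "lookup_inv a q s \<longleftrightarrow> clean 20 s \<and> s 2 = unary a \<and> s 3 = rev (bin q) \<and>
     0 \<notin> set (s 4) \<and> s 8 = [] \<and> s 9 = [] \<and> s 10 = [] \<and> s 11 = []"

lemma scan_below [simp]: "r < b \<Longrightarrow> scan b rest st F s r = s r"
  by (simp add: scan_def)

lemma scan_field [simp]: "b + 2 \<le> r \<Longrightarrow> r \<le> b + 6 \<Longrightarrow> scan b rest st F s r = F (r - b)"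
  by (simp add: scan_def)

lemma scan_upd_below [simp]: "r < b \<Longrightarrow> (scan b rest st F s)(r := v) = scan b rest st F (s(r := v))"
  by (intro ext) (auto simp: scan_def)

lemma unary_eq: "unary m = unary n \<longleftrightarrow> m = n"
  by (simp add: unary_def)

lemma no_zero: "0 \<notin> set (unary n)" "0 \<notin> set (bin n)"
  using set_bin[of n] by (auto simp: unary_def)

lemma psem_lookup:
  assumes "lookup_inv a q s"
  shows "psem (lookup 20) (scan 20 rest 1 (fields t) s) =
    map_option (scan 20 rest 1 (fields t)) (lookup_fun a q t s)"
proof -
  obtain a' q' q2 c d where t: "t = (a', q', q2, c, d)" by (cases t)
  have s: "s 2 = unary a" "s 3 = rev (bin q)" "0 \<notin> set (s 4)" "s 8 = []" "s 9 = []" "s 10 = []" "s 11 = []"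
    using assms by (simp_all add: lookup_inv_def)
  \<comment> \<open>The marks of both comparisons accumulate on stack 10, which is therefore empty
    iff symbol and state both agree.\<close>
  let ?n = "mism (rev (bin q)) (rev (bin q')) + mism (unary a) (unary a')"
  have "psem (lookup 20) (scan 20 rest 1 (fields t) s) =
      psem (Case 10 (\<lambda>x. if x = 0 then
         Case 4 (\<lambda>m. if m = 0 then
             Push 4 1 ;; copy (20 + 4) 5 11 ;; copy (20 + 5) 6 11 ;; copy (20 + 6) 7 11
           else Abort)
       else clear 10)) (scan 20 rest 1 (fields t) (s(10 := replicate ?n 1)))"
    by (simp add: lookup_def s no_zero t replicate_add del: psem.simps(3))
  also have "\<dots> = map_option (scan 20 rest 1 (fields t)) (lookup_fun a q t s)"
  proof (cases "?n = 0")
    case True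
    then have "trans_key t = (a, q)" by (auto simp: mism_eq_0 unary_eq bin_inj t trans_key_def)
    moreover have "s(10 := []) = s" using s by auto
    ultimately show ?thesis using True s
      by (cases "s 4") (auto simp: lookup_fun_def found_def t)
  next
    case False
    then obtain n where n: "?n = Suc n" by (cases ?n) auto
    have "trans_key t \<noteq> (a, q)" using False by (auto simp: mism_eq_0 unary_eq bin_inj t trans_key_def)
    moreover have "s(10 := []) = s" using s by auto
    ultimately show ?thesis by (simp add: n lookup_fun_def del: replicate_add)
  qed
  finally show ?thesis .
qed

lemma lookup_inv_step: "lookup_inv a q s \<Longrightarrow> lookup_fun a q t s = Some s' \<Longrightarrow> lookup_inv a q s'"
  by (auto simp: lookup_inv_def lookup_fun_def found_def clean_def split: if_splits prod.splits)

lemma ofold_lookup_found: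
  "s 4 \<noteq> [] \<Longrightarrow> ofold (lookup_fun a q) ts s = (if matches a q ts = [] then Some s else None)"
  by (induction ts) (auto simp: lookup_fun_def)

lemma ofold_lookup:
  "s 4 = [] \<Longrightarrow> ofold (lookup_fun a q) ts s =
    (case matches a q ts of [] \<Rightarrow> Some s | [t] \<Rightarrow> Some (found t s) | _ \<Rightarrow> None)"
proof (induction ts)
  case (Cons t ts)
  have "found t s 4 \<noteq> []" by (simp add: found_def split: prod.splits)
  note rest = ofold_lookup_found[of "found t s" a q ts, OF this]
  have "lookup_fun a q t s = Some (if trans_key t = (a, q) then found t s else s)"
    using Cons.prems by (simp add: lookup_fun_def)
  then show ?case using rest Cons by (auto split: list.splits)
qed simp

lemma psem_lookup_all:
  assumes "lookup_inv a q s" "s 4 = []" "s 17 = enc_code ts"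
  shows "psem (for_trans 20 (lookup 20)) s =
    (case matches a q ts of [] \<Rightarrow> Some s | [t] \<Rightarrow> Some (found t s) | _ \<Rightarrow> None)"
  unfolding ofold_lookup[of s a q, OF assms(2), symmetric]
proof (rule psem_for_trans[where I = "lookup_inv a q"])
  show "clean 20 s" if "lookup_inv a q s" for s using that by (simp add: lookup_inv_def)
qed (use assms psem_lookup lookup_inv_step in auto)

text \<open>Every transition of the code finds itself, so the inner search aborts iff another
  transition has the same key. The result of the search is discarded.\<close>

definition check_key :: "nat \<Rightarrow> com" where
  "check_key b = copy (b + 2) 2 11 ;; copy (b + 3) 3 11 ;; for_trans 20 (lookup 20) ;;
     clear 4 ;; clear 5 ;; clear 6 ;; clear 7 ;; clear 2 ;; clear 3"

definition check_fun :: "trans list \<Rightarrow> trans \<Rightarrow> store \<Rightarrow> store option" where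
  "check_fun ts t s =
    (if length (filter (\<lambda>u. trans_key u = trans_key t) ts) \<le> 1 then Some s else None)"

definition check_inv :: "trans list \<Rightarrow> store \<Rightarrow> bool" where
  "check_inv ts s \<longleftrightarrow> clean 20 s \<and> clean 30 s \<and> s 17 = enc_code ts \<and> (\<forall>r\<in>{2..11}. s r = [])"

lemma psem_check_key:
  assumes "check_inv ts s"
  shows "psem (check_key 30) (scan 30 rest 1 (fields t) s) =
    map_option (scan 30 rest 1 (fields t)) (check_fun ts t s)"
proof -
  obtain a q q' c d where t: "t = (a, q, q', c, d)" by (cases t)
  have s: "s 2 = []" "s 3 = []" "s 4 = []" "s 5 = []" "s 6 = []" "s 7 = []" "s 8 = []"
    "s 9 = []" "s 10 = []" "s 11 = []" "s 17 = enc_code ts" "clean 20 s"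
    using assms by (simp_all add: check_inv_def)
  let ?s = "scan 30 rest 1 (fields t) (s(2 := unary a, 3 := rev (bin q)))"
  have "psem (check_key 30) (scan 30 rest 1 (fields t) s) =
      Option.bind (psem (for_trans 20 (lookup 20)) ?s)
        (psem (clear 4 ;; clear 5 ;; clear 6 ;; clear 7 ;; clear 2 ;; clear 3))"
    by (simp add: check_key_def s t)
  also have "psem (for_trans 20 (lookup 20)) ?s =
      (case matches a q ts of [] \<Rightarrow> Some ?s | [t] \<Rightarrow> Some (found t ?s) | _ \<Rightarrow> None)"
    by (rule psem_lookup_all) (use s in \<open>auto simp: lookup_inv_def clean_def scan_def\<close>)
  also have "Option.bind (case matches a q ts of [] \<Rightarrow> Some ?s | [t] \<Rightarrow> Some (found t ?s) | _ \<Rightarrow> None)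
        (psem (clear 4 ;; clear 5 ;; clear 6 ;; clear 7 ;; clear 2 ;; clear 3)) =
      map_option (scan 30 rest 1 (fields t)) (check_fun ts t s)"
  proof -
    have r: "s(2 := unary a, 3 := rev (bin q), 4 := [], 5 := [], 6 := [], 7 := [], 2 := [], 3 := []) = s"
      "s(2 := unary a, 3 := rev (bin q), 4 := [1], 5 := x, 6 := y, 7 := z,
          4 := [], 5 := [], 6 := [], 7 := [], 2 := [], 3 := []) = s" for x y z
      using s by (auto intro!: ext)
    have k: "trans_key t = (a, q)" by (simp add: t trans_key_def)
    show ?thesis
    proof (cases "matches a q ts")
      case Nil
      then show ?thesis using r(1) by (simp add: check_fun_def k del: fun_upd_apply)
    next
      case (Cons u us)
      then show ?thesis using r(2)
        by (cases us) (simp_all add: check_fun_def k found_def split: prod.splits)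
    qed
  qed
  finally show ?thesis .
qed

text \<open>The first loop tests only the syntax. After it the nested loops can be analysed under
  the assumption that stack 17 holds the code of some transition list.\<close>

definition check_code :: com where
  "check_code = for_trans 20 Skip ;; for_trans 30 (check_key 30)"

lemma ofold_check:
  "ofold (check_fun us) ts s =
    (if \<forall>t\<in>set ts. length (filter (\<lambda>u. trans_key u = trans_key t) us) \<le> 1 then Some s else None)"
  by (induction ts) (auto simp: check_fun_def)

lemma psem_check_code:
  assumes "clean 20 s" "clean 30 s" "\<forall>r\<in>{2..11}. s r = []"
  shows "psem check_code s = (if proper (s 17) then Some s else None)"
proof (cases "s 17 \<in> range enc_code")
  case True
  then obtain ts where ts: "s 17 = enc_code ts" by blast
  have "psem (for_trans 30 (check_key 30)) s = ofold (check_fun ts) ts s"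
  proof (rule psem_for_trans[where I = "check_inv ts"])
    show "clean 30 s" if "check_inv ts s" for s using that by (simp add: check_inv_def)
    show "check_inv ts s'" if "check_inv ts s" "check_fun ts t s = Some s'" for s t s'
      using that by (simp add: check_fun_def split: if_splits)
    show "check_inv ts s" using assms ts by (simp add: check_inv_def)
  qed (use ts psem_check_key in auto)
  moreover have "det_code ts \<longleftrightarrow>
      (\<forall>t\<in>set ts. length (filter (\<lambda>u. trans_key u = trans_key t) ts) \<le> 1)"
    using det_codeI matches_single by (metis surj_pair)
  ultimately show ?thesis using assms ts
    by (simp add: check_code_def psem_for_trans_Skip proper_enc_code ofold_check)
next
  case False
  then have "\<not> proper (s 17)" by (auto simp: proper_def)
  then show ?thesis using assms False by (simp add: check_code_def psem_for_trans_Skip)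
qed

section \<open>Simulation of the lineage\<close>

lemma psem_Case: "psem (Case r f) s = psem (f (case s r of [] \<Rightarrow> 0 | a # _ \<Rightarrow> a)) (s(r := tl (s r)))"
  by (cases "s r") (auto simp: fun_upd_idem)

declare psem.simps(3) [simp del] psem_Case [simp]

primrec push_ones :: "nat \<Rightarrow> nat \<Rightarrow> com" where
  "push_ones r 0 = Skip"
| "push_ones r (Suc n) = Push r 1 ;; push_ones r n"

lemma psem_push_ones [simp]: "psem (push_ones r n) s = Some (s(r := unary n @ s r))"
  by (induction n arbitrary: s) (simp_all add: unary_def replicate_app_Cons)

primrec push_list :: "nat \<Rightarrow> nat list \<Rightarrow> com" where
  "push_list r [] = Skip"
| "push_list r (a # as) = push_list r as ;; Push r a"

lemma psem_push_list [simp]: "psem (push_list r as) s = Some (s(r := as @ s r))"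
  by (induction as arbitrary: s) simp_all

text \<open>The tape symbols that cannot occur in a proper code are all represented by 5.\<close>

definition cap :: "nat \<Rightarrow> nat" where
  "cap n = min n 5"

text \<open>As many symbols as the unary head position indicates are dropped from a copy of the
  tape. If nothing remains, the pop yields 0, which is just the blank.\<close>

definition read_sym :: com where
  "read_sym = copy 17 15 11 ;; copy 13 16 11 ;; For 16 (\<lambda>_. Case 15 (\<lambda>_. Skip)) ;;
     Case 15 (push_ones 2) ;; clear 15"

text \<open>The top of stack 18 is the parity digit of the state, which determines the mode: 1 means
  odd, that is, reproducing. State 0 is the empty stack, so nothing has to be put back.\<close>

definition select :: com where
  "select = Case 18 (\<lambda>a. (if a = 0 then Skip else Push 18 a) ;; (if a = 1 then read_sym else Input 2))"

text \<open>The unary symbol on stack 6 is counted into a single saturating entry of stack 14. A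
  second digit on stack 7 means a move to the right. At position 0 a left move pops an empty stack,
  in agreement with \<open>0 - 1 = 0\<close>.\<close>

definition write_move :: com where
  "write_move = For 6 (\<lambda>_. Case 14 (\<lambda>c. Push 14 (cap (c + 1)))) ;;
     Case 14 (\<lambda>c. if c = 0 then Skip else Push 12 c) ;;
     Case 7 (\<lambda>_. Case 7 (\<lambda>a. if a = 0 then Case 13 (\<lambda>_. Skip) else Push 13 1))"

text \<open>The symbol 0 means that nothing is written, so not even the terminator 2 is put out.
  Otherwise the 1 popped by this test is restored first.\<close>

definition emit :: com where
  "emit = clear 7 ;;
     Case 6 (\<lambda>a. if a = 0 then Skip else Push 6 1 ;; For 6 (\<lambda>_. Output 1) ;; Output 2)"

text \<open>The output tape has its last symbol on top, so moving it over reverses it into an input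
  tape with the first symbol on top. The start state 0 is the empty stack 18 left by
  \<open>finish\<close>.\<close>

definition spawn :: com where
  "spawn = clear 13 ;; clear 17 ;; For 12 (Push 17)"

text \<open>The special state 1 is the one whose stack is exactly \<open>[1]\<close>, which takes
  two pops to detect; all other states are pushed back.\<close>

definition finish :: com where
  "finish = clear 18 ;; copy 5 18 11 ;; clear 5 ;;
     Case 18 (\<lambda>a. if a = 0 then Skip
       else Case 18 (\<lambda>c. if a = 1 \<and> c = 0 then spawn
         else (if c = 0 then Skip else Push 18 c) ;; Push 18 a))"

text \<open>The old state is saved on stack 3 for the search. An input symbol is consumed before it
  is known whether a transition applies; if none does, the machine halts anyway.\<close>

definition body :: com where
  "body = (check_code ;; copy 18 3 11) ;; select ;;
     (for_trans 20 (lookup 20) ;; Case 4 (\<lambda>m. if m = 0 then Abort else Skip) ;; clear 2 ;; clear 3) ;;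
     Case 18 (\<lambda>a. if a = 1 then write_move else emit) ;; finish"

definition base :: "nat list \<Rightarrow> nat list \<Rightarrow> nat list \<Rightarrow> nat list \<Rightarrow> store" where
  "base T Q Z H = (\<lambda>_. [])(17 := T, 18 := Q, 12 := Z, 13 := H)"

lemma floop_drop: "floop 16 (\<lambda>_. psem (Case 15 (\<lambda>_. Skip))) as s =
    Some (s(16 := [], 15 := drop (length as) (s 15)))"
proof (induction as arbitrary: s)
  case (Cons a as)
  have "floop 16 (\<lambda>_. psem (Case 15 (\<lambda>_. Skip))) as s =
    Some (s(16 := [], 15 := drop (length as) (s 15)))" for s by (rule Cons.IH)
  then have "floop 16 (\<lambda>_. psem (Case 15 (\<lambda>_. Skip))) (a # as) s =
    Some (s(16 := [], 15 := drop (length (a # as)) (s 15)))"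
    by (simp add: fun_upd_twist drop_Suc)
  then show ?case .
next
  case Nil
  have "floop 16 (\<lambda>_. psem (Case 15 (\<lambda>_. Skip))) [] s =
    Some (s(16 := [], 15 := drop (length []) (s 15)))" by (auto intro!: ext)
  then show ?case .
qed

lemma psem_read_sym:
  assumes "s 15 = []" "s 16 = []" "s 11 = []"
  shows "psem read_sym s = Some (s(2 := unary (tape_at (s 17) (length (s 13))) @ s 2))"
proof -
  have "(case drop n xs of [] \<Rightarrow> 0 | a # _ \<Rightarrow> a) = tape_at xs n" for n and xs :: "nat list"
    by (cases "n < length xs") (auto simp: tape_at_def Cons_nth_drop_Suc[symmetric])
  with assms show ?thesis
    by (simp add: read_sym_def floop_drop del: psem_Case)
      (simp, auto intro!: ext)
qed

definition counter :: "nat \<Rightarrow> nat list" where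
  "counter n = (if n = 0 then [] else [cap n])"

text \<open>A saturating counter can be advanced from its truncated value alone.\<close>

lemma cap_cap: "cap (Suc (cap n)) = cap (Suc n)"
  by (simp add: cap_def)

lemma floop_counter:
  "s 14 = counter n \<Longrightarrow> floop 6 (\<lambda>_. psem (Case 14 (\<lambda>c. Push 14 (cap (c + 1))))) as s =
    Some (s(6 := [], 14 := counter (n + length as)))"
proof (induction as arbitrary: s n)
  case Nil
  then have "floop 6 (\<lambda>_. psem (Case 14 (\<lambda>c. Push 14 (cap (c + 1))))) [] s =
    Some (s(6 := [], 14 := counter (n + length [])))" by (auto intro!: ext)
  then show ?case .
next
  case (Cons a as)
  have "psem (Case 14 (\<lambda>c. Push 14 (cap (c + 1)))) (s(6 := as)) =
      Some (s(6 := as, 14 := counter (Suc n)))"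
    using Cons.prems cap_cap[of n]
    by (cases "n = 0") (simp_all add: counter_def One_nat_def)
  moreover have "floop 6 (\<lambda>_. psem (Case 14 (\<lambda>c. Push 14 (cap (c + 1))))) as
      (s(6 := as, 14 := counter (Suc n))) =
    Some ((s(6 := as, 14 := counter (Suc n)))(6 := [], 14 := counter (Suc n + length as)))"
    by (rule Cons.IH) simp
  ultimately have "floop 6 (\<lambda>_. psem (Case 14 (\<lambda>c. Push 14 (cap (c + 1))))) (a # as) s =
    Some (s(6 := [], 14 := counter (n + length (a # as))))"
    by (simp del: psem_Case add: fun_upd_twist)
  then show ?case .
qed

lemma psem_write_move:
  "psem write_move ((base T Q Z (replicate h 1))(5 := x, 6 := unary b, 7 := dir_code d)) =
    Some ((base T Q (rev (map cap (out_sym b)) @ Z) (replicate (move d h) 1))(5 := x))"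
proof -
  let ?s = "(base T Q Z (replicate h 1))(5 := x, 6 := unary b, 7 := dir_code d)"
  have "floop 6 (\<lambda>_. psem (Case 14 (\<lambda>c. Push 14 (cap (c + 1))))) (unary b) ?s =
      Some (?s(6 := [], 14 := counter b))"
    using floop_counter[of ?s 0 "unary b"] by (simp add: base_def counter_def unary_def)
  then have "psem write_move ?s =
      psem (Case 14 (\<lambda>c. if c = 0 then Skip else Push 12 c) ;;
        Case 7 (\<lambda>_. Case 7 (\<lambda>a. if a = 0 then Case 13 (\<lambda>_. Skip) else Push 13 1)))
        (?s(6 := [], 14 := counter b))"
    by (simp add: write_move_def del: psem_Case)
  also have "\<dots> = Some ((base T Q (rev (map cap (out_sym b)) @ Z) (replicate (move d h) 1))(5 := x))"
    by (cases d; cases h)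
      (auto simp: base_def counter_def cap_def out_sym_def intro!: ext)
  finally show ?thesis .
qed

lemma psem_finish:
  "psem finish ((base T Q Z H)(5 := rev (bin q))) =
    Some (if q = 1 then base (rev Z) [] [] [] else base T (rev (bin q)) Z H)"
proof -
  have "psem finish ((base T Q Z H)(5 := rev (bin q))) =
      psem (Case 18 (\<lambda>a. if a = 0 then Skip
       else Case 18 (\<lambda>c. if a = 1 \<and> c = 0 then spawn
         else (if c = 0 then Skip else Push 18 c) ;; Push 18 a))) (base T (rev (bin q)) Z H)"
  proof -
    have "(base T Q Z H)(5 := rev (bin q), 18 := rev (bin q), 5 := []) = base T (rev (bin q)) Z H"
      by (auto simp: base_def intro!: ext)
    then show ?thesis by (simp add: finish_def base_def del: psem_Case)
  qed
  also have "\<dots> = Some (if q = 1 then base (rev Z) [] [] [] else base T (rev (bin q)) Z H)"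
  proof (cases "q = 1")
    case True
    then have "rev (bin q) = [1]" using bin_eq_1 by simp
    with True show ?thesis
      by (simp add: spawn_def base_def floop_push) (auto intro!: ext)
  next
    case False
    then have "rev (bin q) \<noteq> [1]" using bin_eq_1[of q] by (metis rev_rev_ident rev_singleton_conv)
    moreover have "0 \<notin> set (rev (bin q))" using no_zero by simp
    ultimately show ?thesis using False
      by (cases "rev (bin q)"; cases "tl (rev (bin q))") (auto simp: base_def intro!: ext)
  qed
  finally show ?thesis .
qed

section \<open>Programs with input and output\<close>

text \<open>\<open>psem\<close> cannot describe input and output, so \<open>select\<close> and
  \<open>emit\<close> are followed on the machine itself. Quantifying over the continuation makes
  such runs composable.\<close>

definition ev :: "(nat \<Rightarrow> nat) \<Rightarrow> com \<Rightarrow> store \<Rightarrow> nat \<Rightarrow> nat list \<Rightarrow> store \<Rightarrow> nat \<Rightarrow> bool" where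
  "ev y c s p w s' p' \<longleftrightarrow> (\<forall>k. reach (crun y) (c # k, s, p) w (k, s', p'))"

definition stops :: "(nat \<Rightarrow> nat) \<Rightarrow> com \<Rightarrow> store \<Rightarrow> nat \<Rightarrow> bool" where
  "stops y c s p \<longleftrightarrow> (\<forall>k. halts_silently (crun y) (c # k, s, p))"

lemma ev_pure: "pure c \<Longrightarrow> good_store s \<Longrightarrow> psem c s = Some s' \<Longrightarrow> ev y c s p [] s' p"
  using psem_correct[of c s y] by (simp add: ev_def outcome_def)

lemma stops_pure: "pure c \<Longrightarrow> good_store s \<Longrightarrow> psem c s = None \<Longrightarrow> stops y c s p"
  using psem_correct[of c s y] by (simp add: stops_def outcome_def)

lemma ev_Seq:
  assumes "ev y c1 s p w1 s1 p1" "ev y c2 s1 p1 w2 s2 p2"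
  shows "ev y (c1 ;; c2) s p (w1 @ w2) s2 p2"
  unfolding ev_def
proof
  fix k
  have "reach (crun y) (c1 # c2 # k, s, p) (w1 @ w2) (k, s2, p2)"
    by (rule reach_trans[where b = "(c2 # k, s1, p1)"]) (use assms in \<open>auto simp: ev_def\<close>)
  then show "reach (crun y) ((c1 ;; c2) # k, s, p) (w1 @ w2) (k, s2, p2)"
    by (rule reach_step_silent[where st = "crun y", rotated]) simp
qed

lemma ev_Seq_silent:
  "ev y c1 s p [] s1 p1 \<Longrightarrow> ev y c2 s1 p1 w s2 p2 \<Longrightarrow> ev y (c1 ;; c2) s p w s2 p2"
  using ev_Seq[of y c1 s p "[]"] by simp

lemma stops_Seq1: "stops y c1 s p \<Longrightarrow> stops y (c1 ;; c2) s p"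
  unfolding stops_def
  by (auto intro: halts_silently_step[where st = "crun y" and b = "(c1 # c2 # k, s, p)" for k])

lemma stops_Seq2:
  assumes "ev y c1 s p [] s1 p1" "stops y c2 s1 p1" shows "stops y (c1 ;; c2) s p"
  unfolding stops_def
proof
  fix k
  have "halts_silently (crun y) (c1 # c2 # k, s, p)"
    by (rule halts_silently_reach[where b = "(c2 # k, s1, p1)"])
      (use assms in \<open>auto simp: ev_def stops_def\<close>)
  then show "halts_silently (crun y) ((c1 ;; c2) # k, s, p)"
    by (rule halts_silently_step[where st = "crun y", rotated]) simp
qed

lemma ev_Case:
  assumes "ev y (f (case s r of [] \<Rightarrow> 0 | a # _ \<Rightarrow> a)) (s(r := tl (s r))) p w s' p'"
  shows "ev y (Case r f) s p w s' p'"
  unfolding ev_def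
proof
  fix k
  have "reach (crun y) (f (case s r of [] \<Rightarrow> 0 | a # _ \<Rightarrow> a) # k, s(r := tl (s r)), p) w (k, s', p')"
    using assms by (simp add: ev_def)
  then show "reach (crun y) (Case r f # k, s, p) w (k, s', p')"
    by (rule reach_step_silent[where st = "crun y", rotated])
      (auto split: list.splits simp: fun_upd_idem)
qed

lemma ev_Output: "ev y (Output a) s p [a] s p"
  unfolding ev_def
proof
  fix k
  have "reach (crun y) (Output a # k, s, p) ([a] @ []) (k, s, p)"
    by (rule reach_step[where st = "crun y"]) (simp, rule reach_refl)
  then show "reach (crun y) (Output a # k, s, p) [a] (k, s, p)" by simp
qed

lemma ev_For_Output:
  assumes "0 \<notin> set (s r)"
  shows "ev y (For r (\<lambda>_. Output a)) s p (replicate (length (s r)) a) (s(r := [])) p"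
  unfolding ev_def
proof
  fix k
  have "reach (crun y) (For r (\<lambda>_. Output a) # k, s, p) (replicate (length as) a) (k, s(r := []), p)"
    if "s r = as" "0 \<notin> set as" for as s
    using that
  proof (induction as arbitrary: s)
    case Nil
    then have "reach (crun y) (For r (\<lambda>_. Output a) # k, s, p) (replicate (length []) a)
        (k, s(r := []), p)"
      by (simp, intro reach_step_silent[where st = "crun y", OF _ reach_refl]) (simp add: fun_upd_idem)
    then show ?case .
  next
    case (Cons b as)
    let ?k = "For r (\<lambda>_. Output a) # k"
    have "reach (crun y) (?k, s(r := as), p) (replicate (length as) a) (k, (s(r := as))(r := []), p)"
      using Cons.prems by (intro Cons.IH) auto
    moreover have "reach (crun y) (Output a # ?k, s(r := as), p) [a] (?k, s(r := as), p)"
      using ev_Output by (simp add: ev_def)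
    ultimately have "reach (crun y) (Output a # ?k, s(r := as), p)
        ([a] @ replicate (length as) a) (k, (s(r := as))(r := []), p)"
      by (rule reach_trans[rotated])
    then have "reach (crun y) (?k, s, p) ([a] @ replicate (length as) a) (k, (s(r := as))(r := []), p)"
      by (rule reach_step_silent[where st = "crun y", rotated]) (use Cons.prems in simp)
    then have "reach (crun y) (?k, s, p) (replicate (length (b # as)) a) (k, s(r := []), p)" by simp
    then show ?case .
  qed
  then show "reach (crun y) (For r (\<lambda>_. Output a) # k, s, p)
      (replicate (length (s r)) a) (k, s(r := []), p)"
    using assms by blast
qed

lemma ev_Input:
  assumes "\<And>i. i < n \<Longrightarrow> y (p + i) = 1" "y (p + n) \<noteq> 1"
  shows "ev y (Input r) s p [] (s(r := unary n @ s r)) (Suc (p + n))"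
  unfolding ev_def
proof
  fix k
  show "reach (crun y) (Input r # k, s, p) [] (k, s(r := unary n @ s r), Suc (p + n))"
    using assms
  proof (induction n arbitrary: s p)
    case 0
    then have "reach (crun y) (Input r # k, s, p) [] (k, s, Suc p)"
      by (intro reach_step_silent[where st = "crun y", OF _ reach_refl]) simp
    then show ?case by (simp add: unary_def fun_upd_idem)
  next
    case (Suc n)
    have "reach (crun y) (Input r # k, s(r := 1 # s r), Suc p) []
        (k, (s(r := 1 # s r))(r := unary n @ (s(r := 1 # s r)) r), Suc (Suc p + n))"
    proof (rule Suc.IH)
      show "y (Suc p + i) = 1" if "i < n" for i using Suc.prems(1)[of "Suc i"] that by simp
      show "y (Suc p + n) \<noteq> 1" using Suc.prems(2) by simp
    qed
    then have "reach (crun y) (Push r 1 # Input r # k, s, Suc p) []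
        (k, (s(r := 1 # s r))(r := unary n @ (s(r := 1 # s r)) r), Suc (Suc p + n))"
      by (rule reach_step_silent[where st = "crun y", rotated]) simp
    then have "reach (crun y) (Input r # k, s, p) []
        (k, (s(r := 1 # s r))(r := unary n @ (s(r := 1 # s r)) r), Suc (Suc p + n))"
      by (rule reach_step_silent[where st = "crun y", rotated]) (use Suc.prems(1)[of 0] in simp)
    then have "reach (crun y) (Input r # k, s, p) []
        (k, s(r := unary (Suc n) @ s r), Suc (p + Suc n))"
      by (simp add: unary_def replicate_app_Cons)
    then show ?case .
  qed
qed

section \<open>Positions in the encoded input stream\<close>

definition pos :: "(nat \<Rightarrow> nat) \<Rightarrow> nat \<Rightarrow> nat" where
  "pos x k = length (enc_prefix x k)"

lemma enc_prefix_Suc: "enc_prefix x (Suc k) = enc_prefix x k @ sym_enc (x k)"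
  by (simp add: enc_prefix_def)

lemma prefix_enc_prefix: "k \<le> l \<Longrightarrow> prefix (enc_prefix x k) (enc_prefix x l)"
  by (induction l rule: dec_induct) (auto simp: enc_prefix_Suc intro: prefix_prefix)

text \<open>Each block has at least its terminator 2. Hence the first \<open>n + 1\<close> blocks
  cover position \<open>n\<close>, as the definition of \<open>enc_stream\<close>
  presupposes.\<close>

lemma pos_ge: "k \<le> pos x k"
  by (induction k) (auto simp: pos_def enc_prefix_Suc sym_enc_def)

lemma enc_stream_nth:
  assumes "i < pos x k" shows "enc_stream x i = enc_prefix x k ! i"
proof -
  have i: "i < pos x (Suc i)" using pos_ge[of "Suc i" x] by simp
  have "xs ! i = ys ! i" if "prefix xs ys" "i < length xs" for xs ys :: "nat list"
    using that by (auto simp: prefix_def nth_append)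
  then show ?thesis
    using prefix_enc_prefix[of k "Suc i" x] prefix_enc_prefix[of "Suc i" k x] i assms
    unfolding enc_stream_def pos_def by (metis nat_le_linear)
qed

lemma enc_stream_pos:
  "i < x k \<Longrightarrow> enc_stream x (pos x k + i) = 1" "enc_stream x (pos x k + x k) = 2"
  by (subst enc_stream_nth[of _ _ "Suc k"];
      simp add: pos_def enc_prefix_Suc sym_enc_def nth_append)+

lemma pos_Suc: "pos x (Suc k) = Suc (pos x k + x k)"
  by (simp add: pos_def enc_prefix_Suc sym_enc_def)

lemma enc_stream_range: "enc_stream x n \<in> {1, 2}"
proof -
  have "n < length (enc_prefix x (Suc n))" using pos_ge[of "Suc n" x] by (simp add: pos_def)
  then have "enc_stream x n \<in> set (enc_prefix x (Suc n))" by (simp add: enc_stream_def)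
  moreover have "set (enc_prefix x k) \<subseteq> {1, 2}" for k
    by (induction k) (auto simp: enc_prefix_Suc sym_enc_def enc_prefix_def)
  ultimately show ?thesis by blast
qed

section \<open>Syntactic side conditions of the programs\<close>

lemma clear_com [simp]:
  "pure (clear r)" "wf_com K m (clear r) \<longleftrightarrow> r < K" "preserves r' (clear r) \<longleftrightarrow> r' \<noteq> r"
  by (simp_all add: clear_def)

lemma copy_com [simp]:
  "pure (copy r t u) \<longleftrightarrow> r \<noteq> u \<and> t \<noteq> u"
  "wf_com 38 10 (copy r t u) \<longleftrightarrow> r < 38 \<and> t < 38 \<and> u < 38"
  "preserves r' (copy r t u) \<longleftrightarrow> r' \<noteq> r \<and> r' \<noteq> t \<and> r' \<noteq> u"
  by (auto simp: copy_def intro!: exI[of _ 1])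

lemma cmp_com [simp]:
  assumes "r1 \<notin> {8, 9, 10, 11}" "r2 \<notin> {8, 9, 10, 11}"
  shows "pure (cmp r1 r2)" "wf_com 38 10 (cmp r1 r2) \<longleftrightarrow> r1 < 38 \<and> r2 < 38"
    "preserves r (cmp r1 r2) \<longleftrightarrow> r \<notin> {8, 9, 10, 11, r1, r2}"
  using assms by (auto simp: cmp_def cmp_body_def)

text \<open>The bound 10 on stack symbols comes from here, as parser states are kept on a stack. The
  bound 38 on stacks comes from the outer loop, which uses \<open>b + 7\<close> with
  \<open>b = 30\<close>.\<close>

lemma dfa_le: "dfa st x \<le> 10"
  by (simp add: dfa_def)

lemma for_trans_com:
  assumes "17 < b"
  shows "pure E \<Longrightarrow> preserves b E \<Longrightarrow> pure (for_trans b E)"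
    "b + 7 < 38 \<Longrightarrow> wf_com 38 10 E \<Longrightarrow> wf_com 38 10 (for_trans b E)"
    "r \<noteq> 17 \<Longrightarrow> r < b \<or> b + 7 < r \<Longrightarrow> preserves r E \<Longrightarrow> preserves r (for_trans b E)"
proof -
  have f: "2 \<le> field st" "field st \<le> 6" for st using field_range by auto
  have ne: "r \<noteq> b + field st" if "r < b \<or> b + 7 < r" for r st
    using f[of st] that by linarith
  have nz: "field st \<noteq> 0" for st using f(1)[of st] by linarith
  show "pure E \<Longrightarrow> preserves b E \<Longrightarrow> pure (for_trans b E)"
    using assms f by (auto simp: for_trans_def tstep_def nz)
  have "b + field st < 38" if "b + 7 < 38" for st using that f(2)[of st] by simp
  then show "b + 7 < 38 \<Longrightarrow> wf_com 38 10 E \<Longrightarrow> wf_com 38 10 (for_trans b E)"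
    using assms dfa_le by (auto simp: for_trans_def tstep_def Suc_le_eq)
  show "r \<noteq> 17 \<Longrightarrow> r < b \<or> b + 7 < r \<Longrightarrow> preserves r E \<Longrightarrow> preserves r (for_trans b E)"
    using ne by (auto simp: for_trans_def tstep_def)
qed

lemma lookup_com:
  "pure (lookup 20)" "wf_com 38 10 (lookup 20)" "preserves 20 (lookup 20)" "preserves 30 (lookup 20)"
  by (simp_all add: lookup_def)

lemma check_key_com:
  "pure (check_key 30)" "wf_com 38 10 (check_key 30)" "preserves 30 (check_key 30)"
  by (simp_all add: check_key_def for_trans_com lookup_com)

lemma check_code_com: "pure check_code" "wf_com 38 10 check_code"
  by (simp_all add: check_code_def for_trans_com check_key_com)

lemma push_ones_com [simp]: "pure (push_ones r n)" "wf_com 38 10 (push_ones r n) \<longleftrightarrow> n = 0 \<or> r < 38"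
  by (induction n) auto

lemma push_list_com:
  "0 \<notin> set as \<Longrightarrow> pure (push_list r as)"
  "r < 38 \<Longrightarrow> set as \<subseteq> {1..10} \<Longrightarrow> wf_com 38 10 (push_list r as)"
  by (induction as) auto

lemma read_sym_com: "pure read_sym" "wf_com 38 10 read_sym"
  by (simp_all add: read_sym_def)

lemma write_move_com: "pure write_move" "wf_com 38 10 write_move"
proof -
  have "1 \<le> cap (a + 1)" "cap a \<le> 10" for a by (auto simp: cap_def)
  then show "pure write_move" "wf_com 38 10 write_move"
    by (auto simp: write_move_def cap_def)
qed

lemma finish_com: "pure finish" "wf_com 38 10 finish"
  by (simp_all add: finish_def spawn_def)

lemma emit_wf: "wf_com 38 10 emit"
  by (simp add: emit_def)

lemma body_wf: "wf_com 38 10 body"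
  by (simp add: body_def select_def check_code_com for_trans_com lookup_com read_sym_com
      write_move_com finish_com emit_wf)

section \<open>One round of the machine simulates one step of the lineage\<close>

definition conf :: "lcfg \<Rightarrow> store" where
  "conf c = base (map cap (ltape c)) (rev (bin (lst c))) (rev (map cap (lotape c)))
     (replicate (lhd c) 1)"

text \<open>Ensures good stores. It persists because \<open>out_sym\<close> writes nothing for
  0.\<close>

definition no_blanks :: "lcfg \<Rightarrow> bool" where
  "no_blanks c \<longleftrightarrow> 0 \<notin> set (ltape c) \<and> 0 \<notin> set (lotape c)"

text \<open>\<open>cap\<close> fixes 1 to 4 and maps no other number to one of them, so truncation
  can neither create nor destroy a code.\<close>

lemma cap_enc_code: "map cap xs = enc_code ts \<longleftrightarrow> xs = enc_code ts"
proof
  assume *: "map cap xs = enc_code ts"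
  have "cap x = x" if "x \<in> set xs" for x
  proof -
    have "cap x \<in> set (enc_code ts)" using that unfolding *[symmetric] by simp
    then show ?thesis using set_enc_code[of ts] by (auto simp: cap_def)
  qed
  then have "map cap xs = xs" by (simp add: map_idI)
  with * show "xs = enc_code ts" by simp
next
  assume xs: "xs = enc_code ts"
  show "map cap xs = enc_code ts"
    unfolding xs by (rule map_idI) (use set_enc_code[of ts] in \<open>auto simp: cap_def\<close>)
qed

lemma proper_cap: "proper (map cap xs) \<longleftrightarrow> proper xs"
  unfolding proper_def using cap_enc_code by blast

lemma good_base:
  assumes "0 \<notin> set T" "0 \<notin> set Q" "0 \<notin> set Z" "0 \<notin> set H"
  shows "good_store (base T Q Z H)"
  using assms by (auto simp: base_def good_store_def)

lemma good_conf: "no_blanks c \<Longrightarrow> good_store (conf c)"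
  unfolding conf_def no_blanks_def by (rule good_base) (auto simp: cap_def no_zero min_def split: if_splits)

lemma rev_bin: "rev (bin q) = (if q = 0 then [] else (if odd q then 1 else 2) # rev (bin (q div 2)))"
  by (simp add: bin_pos)

lemma not_in_tl: "x \<notin> set xs \<Longrightarrow> x \<notin> set (tl xs)"
  by (cases xs) auto

text \<open>Supplies both premises of \<open>simulation_same_stream\<close> for one execution of
  \<open>body\<close>, with the input position of the lineage translated by
  \<open>pos\<close>.\<close>

lemma ev_body:
  fixes x :: "nat \<Rightarrow> nat" and c :: lcfg
  defines "y \<equiv> enc_stream x"
  assumes nb: "no_blanks c"
  shows "case lstep x c of
      None \<Rightarrow> stops y body (conf c) (pos x (lpos c))
    | Some (c', w) \<Rightarrow> no_blanks c' \<and>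
        ev y body (conf c) (pos x (lpos c)) (concat (map sym_enc w)) (conf c') (pos x (lpos c'))"
proof (cases "proper (ltape c)")
  case False
  have "psem (check_code ;; copy 18 3 11) (conf c) = None"
    using False by (simp add: psem_check_code clean_def conf_def base_def proper_cap)
  then have "stops y (check_code ;; copy 18 3 11) (conf c) (pos x (lpos c))"
    by (intro stops_pure) (simp_all add: check_code_com good_conf[OF nb])
  then show ?thesis using False by (simp add: lstep_def body_def stops_Seq1)
next
  case True
  then obtain ts where ts: "ltape c = enc_code ts" "det_code ts" by (auto simp: proper_def)
  define T Z q h where "T = enc_code ts" and "Z = lotape c" and "q = lst c" and "h = lhd c"
  define S where "S = base T (rev (bin q)) (rev (map cap Z)) (replicate h 1)"
  have capT: "map cap T = T" by (simp add: T_def cap_enc_code)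
  have conf: "conf c = S" by (simp add: conf_def S_def T_def Z_def q_def h_def ts capT[unfolded T_def])
  have good: "good_store S" using good_conf[OF nb] conf by simp
  \<comment> \<open>The observed symbol and the input position after the step, uniformly for both
    modes.\<close>
  define a where "a = (if odd q then tape_at T h else x (lpos c))"
  define p where "p = (if odd q then lpos c else Suc (lpos c))"
  have check: "ev y (check_code ;; copy 18 3 11) S (pos x (lpos c)) []
      (S(3 := rev (bin q))) (pos x (lpos c))"
  proof (rule ev_pure[OF _ good])
    show "psem (check_code ;; copy 18 3 11) S = Some (S(3 := rev (bin q)))"
      using True ts by (simp add: psem_check_code clean_def S_def base_def T_def)
  qed (simp add: check_code_com)
  let ?S2 = "S(3 := rev (bin q), 2 := unary a)"
  have good2: "good_store ?S2" using good by (intro good_store_upd) (simp_all add: no_zero)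
  have select: "ev y select (S(3 := rev (bin q))) (pos x (lpos c)) [] ?S2 (pos x p)"
  proof -
    let ?S1 = "S(3 := rev (bin q))"
    let ?t = "case rev (bin q) of [] \<Rightarrow> 0 | a # _ \<Rightarrow> a"
    have good1: "good_store (?S1(18 := tl (rev (bin q))))"
      using good no_zero(2)[of q] not_in_tl[of 0 "rev (bin q)"] by (intro good_store_upd) auto
    have S18: "?S1 18 = rev (bin q)" by (simp add: S_def base_def)
    have odd: "?t = 1 \<longleftrightarrow> odd q" by (subst rev_bin) auto
    have "psem (if ?t = 0 then Skip else Push 18 ?t) (?S1(18 := tl (rev (bin q)))) = Some ?S1"
      using no_zero(2)[of q] S18 by (cases "rev (bin q)") (auto simp: fun_upd_idem)
    then have restore: "ev y (if ?t = 0 then Skip else Push 18 ?t) (?S1(18 := tl (rev (bin q))))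
        (pos x (lpos c)) [] ?S1 (pos x (lpos c))"
      by (intro ev_pure good1) auto
    have sym: "ev y (if ?t = 1 then read_sym else Input 2) ?S1 (pos x (lpos c)) [] ?S2 (pos x p)"
    proof (cases "odd q")
      case True
      have "psem read_sym ?S1 = Some ?S2"
        using True by (simp add: psem_read_sym S_def base_def a_def)
      moreover have "good_store ?S1" using good by (intro good_store_upd) (simp_all add: no_zero)
      ultimately show ?thesis using True odd read_sym_com by (simp add: ev_pure p_def)
    next
      case False
      then have "ev y (Input 2) ?S1 (pos x (lpos c)) []
          (?S1(2 := unary a @ ?S1 2)) (Suc (pos x (lpos c) + a))"
        by (intro ev_Input) (simp_all add: y_def a_def enc_stream_pos)
      then show ?thesis using False odd by (simp add: p_def pos_Suc a_def S_def base_def)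
    qed
    show ?thesis unfolding select_def
      by (rule ev_Case, unfold S18, rule ev_Seq_silent[OF restore sym])
  qed
  let ?find = "for_trans 20 (lookup 20) ;; Case 4 (\<lambda>m. if m = 0 then Abort else Skip) ;; clear 2 ;; clear 3"
  have pure_find: "pure ?find" by (simp add: for_trans_com lookup_com)
  have find: "psem (for_trans 20 (lookup 20)) ?S2 =
      (case matches a q ts of [] \<Rightarrow> Some ?S2 | [t] \<Rightarrow> Some (found t ?S2) | _ \<Rightarrow> None)"
    by (rule psem_lookup_all) (simp_all add: lookup_inv_def clean_def S_def base_def T_def)
  have delta: "delta_of T (a, q) =
      (case matches a q ts of [] \<Rightarrow> None | (_, _, q', b, d) # _ \<Rightarrow> Some (q', b, d))"
    unfolding T_def by (rule delta_of_enc_code[OF ts(2)])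
  have lstep: "lstep x c = (case delta_of T (a, q) of None \<Rightarrow> None | Some (q', b, d) \<Rightarrow>
      if odd q then
        Some (if q' = 1 then init_cfg (Z @ out_sym b) (lpos c)
          else c\<lparr>lst := q', lhd := move d h, lotape := Z @ out_sym b\<rparr>, [])
      else Some (if q' = 1 then init_cfg Z p else c\<lparr>lst := q', lpos := p\<rparr>, out_sym b))"
    using True by (auto simp: lstep_def is_R_def a_def p_def T_def Z_def q_def h_def ts q1_st_def Let_def
        split: option.splits)
  consider (none) "matches a q ts = []" | (one) t where "matches a q ts = [t]"
    using matches_single[OF ts(2), of a q]
    by (cases "matches a q ts"; cases "tl (matches a q ts)") auto
  then show ?thesis
  proof cases
    case none
    \<comment> \<open>Without a match the flag on stack 4 is never set, and the test after the
      search aborts.\<close>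
    then have "psem ?find ?S2 = None" by (simp add: find) (simp add: S_def base_def)
    then have "stops y ?find ?S2 (pos x p)" by (rule stops_pure[OF pure_find good2])
    then have "stops y body S (pos x (lpos c))"
      unfolding body_def by (rule stops_Seq2[OF check stops_Seq2[OF select stops_Seq1]])
    then show ?thesis by (simp add: lstep delta none conf)
  next
    case one
    obtain a2 q2 q' b d where t: "t = (a2, q2, q', b, d)" by (cases t)
    let ?S3 = "S(5 := rev (bin q'), 6 := unary b, 7 := dir_code d)"
    have S: "S 2 = []" "S 3 = []" "S 4 = []" "S 5 = []" "S 6 = []" "S 7 = []"
      by (simp_all add: S_def base_def)
    have "psem ?find ?S2 = Some ?S3"
      by (simp add: find one found_def t S) (auto simp: S intro!: ext)
    then have find: "ev y ?find ?S2 (pos x p) [] ?S3 (pos x p)"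
      by (rule ev_pure[OF pure_find good2])
    have good3: "good_store ?S3"
      using good by (intro good_store_upd) (auto simp: no_zero, cases d, auto)
    let ?Z = "if odd q then Z @ out_sym b else Z" and ?h = "if odd q then move d h else h"
    let ?w = "if odd q then [] else out_sym b"
    let ?q = "tl (rev (bin q))"
    \<comment> \<open>The old state has lost its parity digit to the mode test;
      \<open>finish\<close> replaces it in any case.\<close>
    let ?S4 = "(base T ?q (rev (map cap ?Z)) (replicate ?h 1))(5 := rev (bin q'))"
    have q0: "0 \<notin> set ?q" using no_zero(2)[of q] by (intro not_in_tl) simp
    have S18: "?S3 18 = rev (bin q)" by (simp add: S_def base_def)
    have odd: "(case rev (bin q) of [] \<Rightarrow> 0 | a # _ \<Rightarrow> a) = 1 \<longleftrightarrow> odd q" by (subst rev_bin) auto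
    have S3: "?S3(18 := ?q) =
        (base T ?q (rev (map cap Z)) (replicate h 1))(5 := rev (bin q'), 6 := unary b, 7 := dir_code d)"
      by (auto simp: S_def base_def intro!: ext)
    have good3': "good_store (?S3(18 := ?q))" by (rule good_store_upd[OF good3 q0])
    have act: "ev y (Case 18 (\<lambda>a. if a = 1 then write_move else emit)) ?S3 (pos x p)
        (concat (map sym_enc ?w)) ?S4 (pos x p)"
    proof (rule ev_Case, unfold S18 odd)
      show "ev y (if odd q then write_move else emit) (?S3(18 := ?q)) (pos x p)
        (concat (map sym_enc ?w)) ?S4 (pos x p)"
      proof (cases "odd q")
        case True
        have "psem write_move (?S3(18 := ?q)) = Some ?S4"
          unfolding S3 psem_write_move using True by simp
        then show ?thesis using True ev_pure[OF write_move_com(1) good3'] by simp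
      next
        case False
        let ?S5 = "(?S3(18 := ?q))(7 := [])"
        have e1: "ev y (clear 7) (?S3(18 := ?q)) (pos x p) [] ?S5 (pos x p)"
          by (rule ev_pure[OF _ good3']) simp_all
        have S5: "?S5 6 = unary b" by simp
        have S4: "?S5(6 := []) = ?S4"
          using False unfolding S3 by (auto simp: base_def intro!: ext)
        let ?out = "Push 6 1 ;; For 6 (\<lambda>_. Output 1) ;; Output 2"
        have "ev y (Case 6 (\<lambda>a. if a = 0 then Skip else ?out)) ?S5 (pos x p)
            (concat (map sym_enc (out_sym b))) ?S4 (pos x p)"
        proof (rule ev_Case, unfold S5, cases b)
          case 0
          have "good_store ?S5" using good3' by (rule good_store_upd) simp
          then have "good_store (?S5(6 := []))" by (rule good_store_upd) simp
          then have "ev y Skip (?S5(6 := [])) (pos x p) [] (?S5(6 := [])) (pos x p)"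
            by (intro ev_pure) simp_all
          then show "ev y (if (case unary b of [] \<Rightarrow> 0 | a # _ \<Rightarrow> a) = 0 then Skip else ?out)
              (?S5(6 := tl (unary b))) (pos x p) (concat (map sym_enc (out_sym b))) ?S4 (pos x p)"
            using 0 unfolding S4[symmetric] by (simp add: unary_def out_sym_def)
        next
          case (Suc n)
          have "good_store ?S5" using good3' by (rule good_store_upd) simp
          then have g: "good_store (?S5(6 := unary n))" by (rule good_store_upd) (rule no_zero)
          have o1: "ev y (Push 6 1) (?S5(6 := unary n)) (pos x p) [] (?S5(6 := unary b)) (pos x p)"
            by (rule ev_pure[OF _ g]) (simp_all add: Suc unary_def)
          have o2: "ev y (For 6 (\<lambda>_. Output 1)) (?S5(6 := unary b)) (pos x p)
              (replicate b 1) (?S5(6 := [])) (pos x p)"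
            using ev_For_Output[of "?S5(6 := unary b)" 6 y 1 "pos x p"] no_zero(1)[of b]
            by (simp add: unary_def)
          have "ev y ?out (?S5(6 := unary n)) (pos x p) (replicate b 1 @ [2]) (?S5(6 := [])) (pos x p)"
            by (rule ev_Seq_silent[OF o1 ev_Seq[OF o2 ev_Output]])
          then show "ev y (if (case unary b of [] \<Rightarrow> 0 | a # _ \<Rightarrow> a) = 0 then Skip else ?out)
              (?S5(6 := tl (unary b))) (pos x p) (concat (map sym_enc (out_sym b))) ?S4 (pos x p)"
            using Suc unfolding S4[symmetric] by (simp add: unary_def out_sym_def sym_enc_def)
        qed
        then show ?thesis using False e1 unfolding emit_def by (simp add: ev_Seq_silent)
      qed
    qed
    let ?c = "if odd q then (if q' = 1 then init_cfg (Z @ out_sym b) (lpos c)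
          else c\<lparr>lst := q', lhd := move d h, lotape := Z @ out_sym b\<rparr>)
        else (if q' = 1 then init_cfg Z p else c\<lparr>lst := q', lpos := p\<rparr>)"
    have step: "lstep x c = Some (?c, ?w)" by (simp add: lstep delta one t)
    have nb': "0 \<notin> set T" "0 \<notin> set Z" using nb ts by (auto simp: no_blanks_def T_def Z_def)
    have Z0: "0 \<notin> set ?Z" using nb' by (auto simp: out_sym_def)
    have p: "lpos ?c = p" by (simp add: init_cfg_def p_def)
    have "conf ?c = (if q' = 1 then base (map cap ?Z) [] [] []
        else base T (rev (bin q')) (rev (map cap ?Z)) (replicate ?h 1))"
      by (simp add: conf_def init_cfg_def q0_st_def ts capT[unfolded T_def] T_def Z_def h_def)
    then have fin: "psem finish ?S4 = Some (conf ?c)" unfolding psem_finish by simp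
    have good4: "good_store ?S4"
      by (intro good_store_upd good_base q0)
        (use nb' Z0 no_zero in \<open>auto simp: cap_def min_def split: if_splits\<close>)
    have "ev y body S (pos x (lpos c)) (concat (map sym_enc ?w)) (conf ?c) (pos x p)"
      unfolding body_def
      using ev_Seq_silent[OF check ev_Seq_silent[OF select ev_Seq_silent[OF find
            ev_Seq[OF act ev_pure[OF finish_com(1) good4 fin]]]]] by simp
    moreover have "no_blanks ?c" using Z0 nb' nb by (auto simp: no_blanks_def init_cfg_def Z_def)
    ultimately show ?thesis using p by (simp add: step conf)
  qed
qed

lemma proper_set: "proper xs \<Longrightarrow> set xs \<subseteq> {1, 2, 3, 4}"
  unfolding proper_def using set_enc_code by blast

theorem theorem1:
  fixes code1 :: "nat list"
  assumes "proper code1"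
  shows "\<exists>M. wf_itm M \<and> i_inalph M = {1, 2} \<and> i_outalph M = {1, 2} \<and>
           (\<forall>x :: nat \<Rightarrow> nat.
              same_stream (\<lambda>n. concat (map sym_enc (lrun x n (init_cfg code1 0))))
                          (\<lambda>n. irun M (enc_stream x) n (iinit M)))"
proof -
  have code: "0 \<notin> set code1" "set code1 \<subseteq> {1..10}" "map cap code1 = code1"
    using proper_set[OF assms] by (auto simp: cap_def intro!: map_idI)
  \<comment> \<open>The code of the first automaton is a constant of the program, loaded silently
    before the simulation starts.\<close>
  define main where "main = push_list 17 code1 ;; Forever body"
  have "wf_com 38 10 main" using code body_wf by (simp add: main_def push_list_com)
  from com_itm[OF this] obtain M where M: "wf_itm M" "i_inalph M = {1, 2}" "i_outalph M = {1, 2}"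
    and sim: "\<And>y. (\<forall>n. y n \<in> {1, 2}) \<Longrightarrow>
      same_stream (\<lambda>n. grun (crun y) n ([main], \<lambda>_. [], 0)) (\<lambda>n. irun M y n (iinit M))"
    by blast
  have "same_stream (\<lambda>n. concat (map sym_enc (lrun x n (init_cfg code1 0))))
      (\<lambda>n. irun M (enc_stream x) n (iinit M))" for x
  proof -
    let ?y = "enc_stream x"
    define R where "R c b \<longleftrightarrow> no_blanks c \<and> b = ([Forever body], conf c, pos x (lpos c))" for c b
    have init: "R (init_cfg code1 0) ([Forever body], (\<lambda>_. [])(17 := code1), 0)"
      using code by (simp add: R_def conf_def no_blanks_def init_cfg_def base_def q0_st_def pos_def
          enc_prefix_def fun_eq_iff)
    \<comment> \<open>Unfolding \<open>Forever\<close> is the machine step that is guaranteed for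
      every simulated step.\<close>
    have loop: "crun ?y ([Forever body], s, p) = Some (([body, Forever body], s, p), [])" for s p
      by simp
    have "same_stream (\<lambda>n. concat (map sym_enc (grun (lstep x) n (init_cfg code1 0))))
        (\<lambda>n. grun (crun ?y) n ([Forever body], (\<lambda>_. [])(17 := code1), 0))"
    proof (rule simulation_same_stream[where R = R])
      fix c b c' w
      assume "R c b" and step: "lstep x c = Some (c', w)"
      then have b: "no_blanks c" "b = ([Forever body], conf c, pos x (lpos c))" by (auto simp: R_def)
      have "no_blanks c'" and "ev ?y body (conf c) (pos x (lpos c)) (concat (map sym_enc w))
          (conf c') (pos x (lpos c'))"
        using ev_body[OF b(1), of x] step by simp_all
      then show "\<exists>b1 w1 w2 b'. crun ?y b = Some (b1, w1) \<and> reach (crun ?y) b1 w2 b' \<and>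
          w1 @ w2 = concat (map sym_enc w) \<and> R c' b'"
        unfolding b(2) loop R_def ev_def by fastforce
    next
      fix c b
      assume "R c b" and step: "lstep x c = None"
      then have b: "no_blanks c" "b = ([Forever body], conf c, pos x (lpos c))" by (auto simp: R_def)
      have "stops ?y body (conf c) (pos x (lpos c))" using ev_body[OF b(1), of x] step by simp
      then show "halts_silently (crun ?y) b"
        unfolding b(2) stops_def by (intro halts_silently_step[where st = "crun ?y", OF loop]) blast
    qed (rule init)
    moreover have "reach (crun ?y) ([main], \<lambda>_. [], 0) []
        ([Forever body], (\<lambda>_. [])(17 := code1), 0)"
    proof -
      have "ev ?y (push_list 17 code1) (\<lambda>_. []) 0 [] ((\<lambda>_. [])(17 := code1)) 0"
        by (rule ev_pure) (use code in \<open>simp_all add: push_list_com good_store_def\<close>)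
      then have "reach (crun ?y) ([push_list 17 code1, Forever body], \<lambda>_. [], 0) []
          ([Forever body], (\<lambda>_. [])(17 := code1), 0)" by (simp add: ev_def)
      then show ?thesis
        by (rule reach_step_silent[where st = "crun ?y", rotated]) (simp add: main_def)
    qed
    ultimately have "same_stream (\<lambda>n. concat (map sym_enc (lrun x n (init_cfg code1 0))))
        (\<lambda>n. grun (crun ?y) n ([main], \<lambda>_. [], 0))"
      unfolding lrun_eq_grun by (rule same_stream_reach)
    moreover have "same_stream (\<lambda>n. grun (crun ?y) n ([main], \<lambda>_. [], 0)) (\<lambda>n. irun M ?y n (iinit M))"
      using sim enc_stream_range by blast
    ultimately show ?thesis by (rule same_stream_trans)
  qed
  with M show ?thesis by blast
qed

end
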